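(* If the polynomial $P_n^{\mathcal{B}^{\beta}}(x_{ij},y_{ij},z_i)$ is a reduced form of $w_{C_n}=x_{12}x_{23}\cdots x_{n-1,n}z_n$ in $\mathcal{B}^{\beta}(C_n)$, then (modulo the commutation relations) $$P_n^{\mathcal{B}^{\beta}}(x_{ij},y_{ij},z_i)=\sum_G\beta^{\,n-|E(G)|}\,m^{\mathcal{B}}[G],$$ where the sum runs over all alternating weakly-well-structured graphs $G$ on the vertex set $[n]$ with lexicographic edge-labels.
   Context: Signed graphs: a signed graph on $[n]=\{1,\dots,n\}$ is a finite multigraph (loops allowed) with each edge labeled $+$ or $-$; all loops are labeled $+$. An edge with endpoints $i,j$ and sign $\epsilon$ is written $(i,j,\epsilon)=(j,i,\epsilon)$. A positive edge is incident with a positive sign to both endpoints; a negative edge is incident with a positive sign to its smaller endpoint and with a negative sign to its larger one. A graph is alternating if at every vertex all incident edges are incident with the same sign. A graph $H$ on $[n]$ with $p\le n$ edges is weakly-well-structured if: (i) $H$ is noncrossing, i.e. there are no $i<j<k<l$ with edges $(i,k,\epsilon_1),(j,l,\epsilon_2)$ of $H$; (ii) for any edges $(i,j,+),(k,l,+)$ with $i<j$, $k<l$: $i<l$ and $k<j$; (iii) for any edges $(i,i,+),(k,l,+)$ with $k<l$: $k\le i\le l$; (iv) there are no edges $(i,i,+),(k,j,-)$ with $k<i<j$; (v) there are no edges $(i,j,+),(k,l,-)$ with $k\le i<j\le l$; (vi) $H$ contains at most one loop and no nonloop cycles; (vii) $H$ contains a positive edge (possibly a loop) incident to vertex $1$.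 Lexicographic order on edges (each written with first index $\le$ second index): any positive edge is less than any negative edge; among edges of the same sign, $(i_1,j_1,\epsilon)$ is less than $(i_2,j_2,\epsilon)$ if $j_1>j_2$, or $j_1=j_2$ and $i_1>i_2$. Edge-labels are lexicographic if lexicographically smaller edges have smaller labels. For an edge-labeled graph $G$ with edges labeled $1,\dots,p$, $m^{\mathcal{B}}[G]=\mathrm{w}_1\cdots\mathrm{w}_p$ is the noncommutative monomial in which $\mathrm{w}_a$ is $x_{ij}$, $y_{ij}$ or $z_i$ according as the edge labeled $a$ is $(i,j,-)$, $(i,j,+)$ with $i<j$, or $(i,i,+)$. Reduced forms in the $\beta$-bracket algebra $\mathcal{B}^{\beta}(C_n)$: work with noncommutative polynomials over $\mathbb{Q}[\beta]$ ($\beta$ a central variable) in $x_{ij},y_{ij}$ $(1\le i<j\le n)$, $z_k$ $(k\in[n])$, modulo the commutations saying that two variables with disjoint index sets commute. Reduction rules (applied to two adjacent letters of a monomial, possibly after commutations; for $i<j<k$ in (5)–(8'), $i<j$ in (9),(9')): (5) $x_{ij}x_{jk}\to x_{ik}x_{ij}+x_{jk}x_{ik}+\beta x_{ik}$; (5') $x_{jk}x_{ij}\to x_{ij}x_{ik}+x_{ik}x_{jk}+\beta x_{ik}$; (6) $x_{ij}y_{jk}\to y_{ik}x_{ij}+y_{jk}y_{ik}+\beta y_{ik}$; (6') $y_{jk}x_{ij}\to x_{ij}y_{ik}+y_{ik}y_{jk}+\beta y_{ik}$; (7) $x_{ik}y_{jk}\to y_{jk}y_{ij}+y_{ij}x_{ik}+\beta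 y_{ij}$; (7') $y_{jk}x_{ik}\to y_{ij}y_{jk}+x_{ik}y_{ij}+\beta y_{ij}$; (8) $y_{ik}x_{jk}\to x_{jk}y_{ij}+y_{ij}y_{ik}+\beta y_{ij}$; (8') $x_{jk}y_{ik}\to y_{ij}x_{jk}+y_{ik}y_{ij}+\beta y_{ij}$; (9) $x_{ij}z_j\to z_ix_{ij}+y_{ij}z_i+z_jy_{ij}+\beta z_i+\beta y_{ij}$; (9') $z_jx_{ij}\to x_{ij}z_i+z_iy_{ij}+y_{ij}z_j+\beta z_i+\beta y_{ij}$. A reduced form of a monomial is a polynomial obtained from it by successively applying these rules to monomials of the current polynomial, in any order, until no rule can be applied (even after commutations). *)

theory Defs
  imports "HOL-Library.Poly_Mapping" "HOL-Computational_Algebra.Polynomial"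
begin

section \<open>Noncommutative polynomials modulo commutations\<close>

datatype letter = X nat nat | Y nat nat | Z nat

fun indices :: "letter \<Rightarrow> nat set" where
  "indices (X i j) = {i, j}"
| "indices (Y i j) = {i, j}"
| "indices (Z i) = {i}"

inductive commute_step :: "letter list \<Rightarrow> letter list \<Rightarrow> bool" where
  "indices a \<inter> indices b = {} \<Longrightarrow> commute_step (u @ [a, b] @ v) (u @ [b, a] @ v)"

definition commute_eq :: "letter list \<Rightarrow> letter list \<Rightarrow> bool" where
  "commute_eq = commute_step\<^sup>*\<^sup>*"

lemma commute_step_sym: "commute_step u v \<Longrightarrow> commute_step v u"
  by (auto elim!: commute_step.cases intro!: commute_step.intros)

lemma commute_eq_sym: "commute_eq u v \<Longrightarrow> commute_eq v u"
  unfolding commute_eq_def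
  by (induction rule: rtranclp_induct)
    (auto intro: converse_rtranclp_into_rtranclp commute_step_sym)

lemma commute_eq_equivp: "equivp commute_eq"
proof (rule equivpI)
  show "reflp commute_eq"
    by (simp add: commute_eq_def reflp_def)
  show "symp commute_eq"
    by (rule sympI) (rule commute_eq_sym)
  show "transp commute_eq"
    unfolding commute_eq_def by (rule transpI) (rule rtranclp_trans)
qed

lemma commute_step_context: "commute_step u v \<Longrightarrow> commute_step (p @ u @ q) (p @ v @ q)"
proof (erule commute_step.cases)
  fix a b s t
  assume "u = s @ [a, b] @ t" "v = s @ [b, a] @ t" "indices a \<inter> indices b = {}"
  then show "commute_step (p @ u @ q) (p @ v @ q)"
    using commute_step.intros[of a b "p @ s" "t @ q"] by simp
qed

lemma commute_eq_context: "commute_eq u v \<Longrightarrow> commute_eq (p @ u @ q) (p @ v @ q)"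
  unfolding commute_eq_def
  by (induction rule: rtranclp_induct)
    (auto intro: rtranclp.rtrancl_into_rtrancl commute_step_context)

lemma commute_eq_append:
  assumes "commute_eq u u'" "commute_eq v v'"
  shows "commute_eq (u @ v) (u' @ v')"
  using commute_eq_context[OF assms(1), of "[]" v] commute_eq_context[OF assms(2), of u' "[]"]
  unfolding commute_eq_def by (metis append_Nil append_Nil2 rtranclp_trans)

text \<open>A monomial is a word up to commutations. Concatenation is written additively, since
  that is what the convolution product of \<^type>\<open>poly_mapping\<close> expects of its keys;
  \<open>+\<close> is not commutative on this type.\<close>

quotient_type monomial = "letter list" / commute_eq
  by (rule commute_eq_equivp)

instantiation monomial :: monoid_add
begin

lift_definition zero_monomial :: monomial is "[]" .

lift_definition plus_monomial :: "monomial \<Rightarrow> monomial \<Rightarrow> monomial" is "(@)"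
  by (rule commute_eq_append)

instance
  by standard (transfer, simp add: commute_eq_def)+

end

lift_definition letter_monomial :: "letter \<Rightarrow> monomial" is "\<lambda>a. [a]" .

text \<open>The coefficient ring \<^typ>\<open>rat poly\<close> is $\mathbb{Q}[\beta]$, so the following type is the
  quotient of the free $\mathbb{Q}[\beta]$-algebra on the letters by the commutations.\<close>

type_synonym ncpoly = "monomial \<Rightarrow>\<^sub>0 rat poly"

definition beta :: ncpoly  (\<open>\<beta>\<close>) where
  "\<beta> = Poly_Mapping.single 0 [:0, 1:]"

definition var :: "letter \<Rightarrow> ncpoly" where
  "var a = Poly_Mapping.single (letter_monomial a) 1"

abbreviation xvar :: "nat \<Rightarrow> nat \<Rightarrow> ncpoly" where "xvar i j \<equiv> var (X i j)"
abbreviation yvar :: "nat \<Rightarrow> nat \<Rightarrow> ncpoly" where "yvar i j \<equiv> var (Y i j)"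
abbreviation zvar :: "nat \<Rightarrow> ncpoly" where "zvar i \<equiv> var (Z i)"


section \<open>Reduced forms in the $\beta$-bracket algebra of type $C_n$\<close>

text \<open>\<open>bracket_rule n a b r\<close> is the rule that replaces the adjacent letters \<open>a b\<close> by \<open>r\<close>.\<close>

inductive bracket_rule :: "nat \<Rightarrow> letter \<Rightarrow> letter \<Rightarrow> ncpoly \<Rightarrow> bool" for n :: nat where
  x_x: "\<lbrakk>1 \<le> i; i < j; j < k; k \<le> n\<rbrakk> \<Longrightarrow> bracket_rule n (X i j) (X j k)
        (xvar i k * xvar i j + xvar j k * xvar i k + \<beta> * xvar i k)"
| x_x': "\<lbrakk>1 \<le> i; i < j; j < k; k \<le> n\<rbrakk> \<Longrightarrow> bracket_rule n (X j k) (X i j)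
        (xvar i j * xvar i k + xvar i k * xvar j k + \<beta> * xvar i k)"
| x_y: "\<lbrakk>1 \<le> i; i < j; j < k; k \<le> n\<rbrakk> \<Longrightarrow> bracket_rule n (X i j) (Y j k)
        (yvar i k * xvar i j + yvar j k * yvar i k + \<beta> * yvar i k)"
| x_y': "\<lbrakk>1 \<le> i; i < j; j < k; k \<le> n\<rbrakk> \<Longrightarrow> bracket_rule n (Y j k) (X i j)
        (xvar i j * yvar i k + yvar i k * yvar j k + \<beta> * yvar i k)"
| x_y_end: "\<lbrakk>1 \<le> i; i < j; j < k; k \<le> n\<rbrakk> \<Longrightarrow> bracket_rule n (X i k) (Y j k)
        (yvar j k * yvar i j + yvar i j * xvar i k + \<beta> * yvar i j)"
| x_y_end': "\<lbrakk>1 \<le> i; i < j; j < k; k \<le> n\<rbrakk> \<Longrightarrow> bracket_rule n (Y j k) (X i k)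
        (yvar i j * yvar j k + xvar i k * yvar i j + \<beta> * yvar i j)"
| y_x_end: "\<lbrakk>1 \<le> i; i < j; j < k; k \<le> n\<rbrakk> \<Longrightarrow> bracket_rule n (Y i k) (X j k)
        (xvar j k * yvar i j + yvar i j * yvar i k + \<beta> * yvar i j)"
| y_x_end': "\<lbrakk>1 \<le> i; i < j; j < k; k \<le> n\<rbrakk> \<Longrightarrow> bracket_rule n (X j k) (Y i k)
        (yvar i j * xvar j k + yvar i k * yvar i j + \<beta> * yvar i j)"
| x_z: "\<lbrakk>1 \<le> i; i < j; j \<le> n\<rbrakk> \<Longrightarrow> bracket_rule n (X i j) (Z j)
        (zvar i * xvar i j + yvar i j * zvar i + zvar j * yvar i j + \<beta> * zvar i + \<beta> * yvar i j)"
| x_z': "\<lbrakk>1 \<le> i; i < j; j \<le> n\<rbrakk> \<Longrightarrow> bracket_rule n (Z j) (X i j)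
        (xvar i j * zvar i + zvar i * yvar i j + yvar i j * zvar j + \<beta> * zvar i + \<beta> * yvar i j)"

text \<open>Commutations before a rule is applied are covered by the equation between
  monomials, which are words up to commutations.\<close>

inductive reduction_step :: "nat \<Rightarrow> ncpoly \<Rightarrow> ncpoly \<Rightarrow> bool" for n :: nat where
  "\<lbrakk>m \<in> Poly_Mapping.keys P; m = u + letter_monomial a + letter_monomial b + v;
    bracket_rule n a b r; c = Poly_Mapping.lookup P m\<rbrakk> \<Longrightarrow>
    reduction_step n P
      (P - Poly_Mapping.single m c + Poly_Mapping.single u c * r * Poly_Mapping.single v 1)"

definition reduced_form :: "nat \<Rightarrow> ncpoly \<Rightarrow> ncpoly \<Rightarrow> bool" where
  "reduced_form n w P \<longleftrightarrow> (reduction_step n)\<^sup>*\<^sup>* w P \<and> \<not> (\<exists>Q. reduction_step n P Q)"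

definition w_C :: "nat \<Rightarrow> ncpoly" where
  "w_C n = prod_list (map (\<lambda>i. xvar i (i + 1)) [1..<n]) * zvar n"


section \<open>Edge-labeled signed graphs\<close>

datatype sign = Pos | Neg

type_synonym edge = "nat \<times> nat \<times> sign"

text \<open>An edge-labeled signed multigraph is the list of its edges in the order of their labels:
  the edge labeled \<open>a\<close> (for \<open>1 \<le> a \<le> length G\<close>) is \<open>G ! (a - 1)\<close>. An edge is written with its
  smaller endpoint first. Parallel edges are repeated entries.\<close>

type_synonym lgraph = "edge list"

definition signed_graph :: "nat \<Rightarrow> lgraph \<Rightarrow> bool" where
  "signed_graph n G \<longleftrightarrow>
    (\<forall>(i, j, s) \<in> set G. 1 \<le> i \<and> i \<le> j \<and> j \<le> n \<and> (i = j \<longrightarrow> s = Pos))"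

inductive incident :: "edge \<Rightarrow> nat \<Rightarrow> sign \<Rightarrow> bool" where
  "incident (i, j, Pos) i Pos"
| "incident (i, j, Pos) j Pos"
| "incident (i, j, Neg) i Pos"
| "incident (i, j, Neg) j Neg"

definition alternating :: "lgraph \<Rightarrow> bool" where
  "alternating G \<longleftrightarrow> (\<forall>e \<in> set G. \<forall>f \<in> set G. \<forall>v s t.
    incident e v s \<longrightarrow> incident f v t \<longrightarrow> s = t)"

fun joins :: "edge \<Rightarrow> nat \<Rightarrow> nat \<Rightarrow> bool" where
  "joins (i, j, s) u v \<longleftrightarrow> (u = i \<and> v = j) \<or> (u = j \<and> v = i)"

text \<open>A nonloop cycle has at least two distinct vertices \<open>vs\<close> and equally many edges, given by
  distinct positions \<open>as\<close> in the list, so that two parallel edges form a cycle.\<close>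

definition has_nonloop_cycle :: "lgraph \<Rightarrow> bool" where
  "has_nonloop_cycle G \<longleftrightarrow> (\<exists>vs as. length vs \<ge> 2 \<and> length as = length vs \<and>
    distinct vs \<and> distinct as \<and> set as \<subseteq> {..<length G} \<and>
    (\<forall>t < length vs. joins (G ! (as ! t)) (vs ! t) (vs ! (Suc t mod length vs))))"

definition weakly_well_structured :: "nat \<Rightarrow> lgraph \<Rightarrow> bool" where
  "weakly_well_structured n G \<longleftrightarrow>
    signed_graph n G \<and> length G \<le> n \<and>
    \<not> (\<exists>i j k l s t. i < j \<and> j < k \<and> k < l \<and> (i, k, s) \<in> set G \<and> (j, l, t) \<in> set G) \<and>
    (\<forall>i j k l. (i, j, Pos) \<in> set G \<longrightarrow> (k, l, Pos) \<in> set G \<longrightarrow> i < j \<longrightarrow> k < l \<longrightarrow> i < l \<and> k < j) \<and>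
    (\<forall>i k l. (i, i, Pos) \<in> set G \<longrightarrow> (k, l, Pos) \<in> set G \<longrightarrow> k < l \<longrightarrow> k \<le> i \<and> i \<le> l) \<and>
    \<not> (\<exists>i j k. (i, i, Pos) \<in> set G \<and> (k, j, Neg) \<in> set G \<and> k < i \<and> i < j) \<and>
    \<not> (\<exists>i j k l. (i, j, Pos) \<in> set G \<and> (k, l, Neg) \<in> set G \<and> k \<le> i \<and> i < j \<and> j \<le> l) \<and>
    length (filter (\<lambda>(i, j, s). i = j) G) \<le> 1 \<and> \<not> has_nonloop_cycle G \<and>
    (\<exists>j. (1, j, Pos) \<in> set G)"

fun lex_less :: "edge \<Rightarrow> edge \<Rightarrow> bool" where
  "lex_less (i1, j1, s1) (i2, j2, s2) \<longleftrightarrow>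
    (s1 = Pos \<and> s2 = Neg) \<or> (s1 = s2 \<and> (j1 > j2 \<or> (j1 = j2 \<and> i1 > i2)))"

definition lexicographic_labels :: "lgraph \<Rightarrow> bool" where
  "lexicographic_labels G \<longleftrightarrow>
    (\<forall>a < length G. \<forall>b < length G. lex_less (G ! a) (G ! b) \<longrightarrow> a < b)"

fun edge_letter :: "edge \<Rightarrow> letter" where
  "edge_letter (i, j, Neg) = X i j"
| "edge_letter (i, j, Pos) = (if i = j then Z i else Y i j)"

definition graph_monomial :: "lgraph \<Rightarrow> ncpoly" where
  "graph_monomial G = prod_list (map (\<lambda>e. var (edge_letter e)) G)"

text \<open>There is one such list per graph, because a graph without nonloop cycles and with at most
  one loop has no repeated edges.\<close>

definition C_graphs :: "nat \<Rightarrow> lgraph set" where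
  "C_graphs n = {G. weakly_well_structured n G \<and> alternating G \<and> lexicographic_labels G}"

lemma finite_C_graphs: "finite (C_graphs n)"
proof -
  have "finite (UNIV :: sign set)"
    by (rule finite_subset[of _ "{Pos, Neg}"]) (auto intro: sign.exhaust)
  then have "finite ({..n} \<times> {..n} \<times> (UNIV :: sign set))"
    by simp
  then have "finite {G. set G \<subseteq> {..n} \<times> {..n} \<times> (UNIV :: sign set) \<and> length G \<le> n}"
    by (rule finite_lists_length_le)
  moreover have "C_graphs n \<subseteq> {G. set G \<subseteq> {..n} \<times> {..n} \<times> UNIV \<and> length G \<le> n}"
  proof
    fix G assume "G \<in> C_graphs n"
    then have "signed_graph n G" and "length G \<le> n"
      by (simp_all add: C_graphs_def weakly_well_structured_def)
    then show "G \<in> {G. set G \<subseteq> {..n} \<times> {..n} \<times> UNIV \<and> length G \<le> n}"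
      unfolding signed_graph_def by fastforce
  qed
  ultimately show ?thesis
    by (rule rev_finite_subset)
qed

end

theory Submission
  imports Defs "HOL-Library.Product_Lexorder"
begin

text \<open>Attach to \<open>x\<^sub>i\<^sub>j\<close>, \<open>y\<^sub>i\<^sub>j\<close> and \<open>z\<^sub>i\<close> the vectors \<open>e\<^sub>i - e\<^sub>j\<close>, \<open>e\<^sub>i + e\<^sub>j\<close> and \<open>e\<^sub>i\<close>. Every
  reduction rule then cuts the open cone over two vectors into unimodular open cones, so for every
  vector \<open>p\<close> the functional \<open>m \<mapsto> \<beta>\<^bsup>deg m\<^esup> \<cdot> #{positive integer weights on the letters of m with
  weighted sum p}\<close> is invariant under reduction. The monomials that occur during a reduction of
  \<open>w\<^sub>C\<close> obey pairwise conditions (noncrossing etc.) together with a prescribed relative order of any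
  two letters that share an index; such a monomial is determined by its set of letters, and if it is
  irreducible then its graph is alternating. For alternating graphs satisfying the pairwise
  conditions, the graph and its weights can be recovered from the weighted sum. Hence choosing \<open>p\<close>
  as the sum of the vectors of a monomial \<open>m\<close> isolates the coefficient of \<open>m\<close> in the reduced form,
  and evaluating the functional at \<open>w\<^sub>C\<close> shows that it is \<open>\<beta>\<^bsup>n - deg m\<^esup>\<close> or 0, according to whether
  all partial sums of \<open>p\<close> are positive; the latter condition amounts to a positive edge at
  vertex 1.\<close>

section \<open>Well-ordered words\<close>

text \<open>The rules may be applied in any order, and no confluence argument is made: the
  functionals determine every coefficient of any irreducible result. The cones are open so that a
  cut yields a disjoint union. The dividing ray is the term carrying \<beta>, and weighting a
  monomial by \<beta> to its degree makes up for the letter that this term loses. Two obstacles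
  shape the invariant. Rules act on commutation classes, so a pair of letters that violates
  alternation contradicts irreducibility only after the two letters have been moved next to each
  other; the prescribed order of letters is what makes this possible. And the absence of cycles is
  not a condition on pairs of edges, so it is carried separately, as linear independence modulo
  2.\<close>

fun lo :: "letter \<Rightarrow> nat" where
  "lo (X i j) = i" | "lo (Y i j) = i" | "lo (Z i) = i"

fun hi :: "letter \<Rightarrow> nat" where
  "hi (X i j) = j" | "hi (Y i j) = j" | "hi (Z i) = i"

fun positive :: "letter \<Rightarrow> bool" where
  "positive (X i j) = False" | "positive (Y i j) = True" | "positive (Z i) = True"

fun valid :: "nat \<Rightarrow> letter \<Rightarrow> bool" where
  "valid n (X i j) \<longleftrightarrow> 1 \<le> i \<and> i < j \<and> j \<le> n"
| "valid n (Y i j) \<longleftrightarrow> 1 \<le> i \<and> i < j \<and> j \<le> n"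
| "valid n (Z i) \<longleftrightarrow> 1 \<le> i \<and> i \<le> n"

definition crossing :: "letter \<Rightarrow> letter \<Rightarrow> bool" where
  "crossing a b \<longleftrightarrow> lo a < lo b \<and> lo b < hi a \<and> hi a < hi b"

text \<open>The loop-loop clause bounds the number of loops by one. The catch-all clause leaves the
  mirrored argument orders to \<open>compatible\<close>, which tests both; as a loop is not
  compatible with itself, \<open>compatible\<close> is meant for distinct letters.\<close>

fun admissible :: "letter \<Rightarrow> letter \<Rightarrow> bool" where
  "admissible (Z i) (Z j) \<longleftrightarrow> False"
| "admissible (Z i) (Y k l) \<longleftrightarrow> k \<le> i \<and> i \<le> l"
| "admissible (Z i) (X k l) \<longleftrightarrow> \<not> (k < i \<and> i < l)"
| "admissible (Y i j) (Y k l) \<longleftrightarrow> i < l \<and> k < j"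
| "admissible (Y i j) (X k l) \<longleftrightarrow> \<not> (k \<le> i \<and> j \<le> l)"
| "admissible _ _ \<longleftrightarrow> True"

definition compatible :: "letter \<Rightarrow> letter \<Rightarrow> bool" where
  "compatible a b \<longleftrightarrow> \<not> crossing a b \<and> \<not> crossing b a \<and> admissible a b \<and> admissible b a"

lemma compatible_sym: "compatible a b \<Longrightarrow> compatible b a"
  by (auto simp: compatible_def)

text \<open>In a monomial that occurs during the reduction, two letters sharing an index appear in
  lexicographic order, unless they show opposite signs at a common vertex; then the letter with the
  negative sign comes first.\<close>

fun before :: "letter \<Rightarrow> letter \<Rightarrow> bool" where
  "before (X i j) (X k l) \<longleftrightarrow> j = k \<or> (i = k \<and> l < j) \<or> (j = l \<and> k < i)"
| "before (X i j) b \<longleftrightarrow> j = lo b \<or> j = hi b"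
| "before a (X k l) \<longleftrightarrow> l \<noteq> lo a \<and> l \<noteq> hi a"
| "before a b \<longleftrightarrow> hi b < hi a \<or> (hi b = hi a \<and> lo b < lo a)"

definition vertex_disjoint :: "letter \<Rightarrow> letter \<Rightarrow> bool" where
  "vertex_disjoint a b \<longleftrightarrow> lo a \<noteq> lo b \<and> lo a \<noteq> hi b \<and> hi a \<noteq> lo b \<and> hi a \<noteq> hi b"

lemma vertex_disjoint_sym: "vertex_disjoint a b \<Longrightarrow> vertex_disjoint b a"
  by (auto simp: vertex_disjoint_def)

lemma indices_lo_hi: "indices a = {lo a, hi a}"
  by (cases a) auto

lemma vertex_disjoint_iff: "vertex_disjoint a b \<longleftrightarrow> indices a \<inter> indices b = {}"
  by (auto simp: vertex_disjoint_def indices_lo_hi)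

text \<open>Disjoint compatible letters precede each other in both directions, and
  \<open>sorted_wrt\<close> inspects all pairs. So being sorted is a property of the commutation
  class and not only of the word.\<close>

definition precedes :: "letter \<Rightarrow> letter \<Rightarrow> bool" where
  "precedes a b \<longleftrightarrow> compatible a b \<and> (vertex_disjoint a b \<or> before a b)"

lemmas precedes_simps = precedes_def compatible_def crossing_def vertex_disjoint_def

lemma precedes_irrefl: "valid n a \<Longrightarrow> \<not> precedes a a"
  by (cases a) (auto simp: precedes_simps)

lemma precedes_antisym:
  assumes "precedes a b" "precedes b a" "valid n a" "valid n b"
  shows "vertex_disjoint a b"
  using assms by (cases a; cases b) (auto simp: precedes_simps)

text \<open>Only these rules can be applied to a word sorted by \<^const>\<open>precedes\<close>: the rules (5'), (6'), (8)
  and (9') have their letters in the opposite order, and (7) and (7') would require a positive edge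
  below a negative one.\<close>

inductive expansion :: "nat \<Rightarrow> letter \<Rightarrow> letter \<Rightarrow> letter list list \<Rightarrow> bool" for n where
  xx: "\<lbrakk>1 \<le> i; i < j; j < k; k \<le> n\<rbrakk> \<Longrightarrow>
    expansion n (X i j) (X j k) [[X i k, X i j], [X j k, X i k], [X i k]]"
| xy: "\<lbrakk>1 \<le> i; i < j; j < k; k \<le> n\<rbrakk> \<Longrightarrow>
    expansion n (X i j) (Y j k) [[Y i k, X i j], [Y j k, Y i k], [Y i k]]"
| yx_end: "\<lbrakk>1 \<le> i; i < j; j < k; k \<le> n\<rbrakk> \<Longrightarrow>
    expansion n (X j k) (Y i k) [[Y i j, X j k], [Y i k, Y i j], [Y i j]]"
| xz: "\<lbrakk>1 \<le> i; i < j; j \<le> n\<rbrakk> \<Longrightarrow>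
    expansion n (X i j) (Z j) [[Z i, X i j], [Y i j, Z i], [Z j, Y i j], [Z i], [Y i j]]"

lemma expansion_valid:
  "expansion n a b rs \<Longrightarrow> t \<in> set rs \<Longrightarrow> x \<in> set t \<Longrightarrow> valid n x"
  by (induction rule: expansion.induct) auto

lemma expansion_sorted:
  "expansion n a b rs \<Longrightarrow> t \<in> set rs \<Longrightarrow> sorted_wrt precedes t"
  by (induction rule: expansion.induct) (auto simp: precedes_simps)

text \<open>A third letter interacts with a rule only through the positions of its endpoints
  relative to the indices of the rule. Splitting into these positions turns the closure proofs below
  into finitely many cases, each settled by simplification.\<close>

lemma position_among_three:
  fixes i j k p :: nat
  assumes "i < j" "j < k"
  obtains "p < i" | "p = i" | "i < p" "p < j" | "p = j" | "j < p" "p < k" | "p = k" | "k < p"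
  using assms by linarith

lemma position_among_two:
  fixes i j p :: nat
  assumes "i < j"
  obtains "p < i" | "p = i" | "i < p" "p < j" | "p = j" | "j < p"
  using assms by linarith

text \<open>The rewritten letters are adjacent, so every other letter stands on the same side of
  both. The right-hand sides consist of \<open>a\<close>, \<open>b\<close> and new letters whose
  vectors are sums; only the new ones have to be checked against \<open>c\<close>, namely one for
  each of the first three rules, and \<open>Z i\<close> and \<open>Y i j\<close> for the loop
  rule.\<close>

lemma expansion_precedes_left:
  assumes "expansion n a b rs" "t \<in> set rs" "x \<in> set t" "valid n c" "precedes c a" "precedes c b"
  shows "precedes c x"
  using assms(1)
proof cases
  case (xx i j k)
  have "precedes c (X i k)"
  proof (cases c)
    case (X p q)
    have "p < q" "precedes (X p q) (X i j)" "precedes (X p q) (X j k)"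
      using assms(4-6) xx X by auto
    with \<open>i < j\<close> \<open>j < k\<close> have "precedes (X p q) (X i k)"
      by - (rule position_among_three[OF \<open>i < j\<close> \<open>j < k\<close>, of p];
        rule position_among_three[OF \<open>i < j\<close> \<open>j < k\<close>, of q]; simp add: precedes_simps)
    then show ?thesis
      by (simp add: X)
  next
    case (Y p q)
    have "p < q" "precedes (Y p q) (X i j)" "precedes (Y p q) (X j k)"
      using assms(4-6) xx Y by auto
    with \<open>i < j\<close> \<open>j < k\<close> have "precedes (Y p q) (X i k)"
      by - (rule position_among_three[OF \<open>i < j\<close> \<open>j < k\<close>, of p];
        rule position_among_three[OF \<open>i < j\<close> \<open>j < k\<close>, of q]; simp add: precedes_simps)
    then show ?thesis
      by (simp add: Y)
  next
    case (Z p)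
    have "precedes (Z p) (X i j)" "precedes (Z p) (X j k)"
      using assms(4-6) xx Z by auto
    with \<open>i < j\<close> \<open>j < k\<close> have "precedes (Z p) (X i k)"
      by - (rule position_among_three[OF \<open>i < j\<close> \<open>j < k\<close>, of p]; simp add: precedes_simps)
    then show ?thesis
      by (simp add: Z)
  qed
  then show ?thesis
    using assms(2,3,5,6) xx by auto
next
  case (xy i j k)
  have "precedes c (Y i k)"
  proof (cases c)
    case (X p q)
    have "p < q" "precedes (X p q) (X i j)" "precedes (X p q) (Y j k)"
      using assms(4-6) xy X by auto
    with \<open>i < j\<close> \<open>j < k\<close> have "precedes (X p q) (Y i k)"
      by - (rule position_among_three[OF \<open>i < j\<close> \<open>j < k\<close>, of p];
        rule position_among_three[OF \<open>i < j\<close> \<open>j < k\<close>, of q]; simp add: precedes_simps)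
    then show ?thesis
      by (simp add: X)
  next
    case (Y p q)
    have "p < q" "precedes (Y p q) (X i j)" "precedes (Y p q) (Y j k)"
      using assms(4-6) xy Y by auto
    with \<open>i < j\<close> \<open>j < k\<close> have "precedes (Y p q) (Y i k)"
      by - (rule position_among_three[OF \<open>i < j\<close> \<open>j < k\<close>, of p];
        rule position_among_three[OF \<open>i < j\<close> \<open>j < k\<close>, of q]; simp add: precedes_simps)
    then show ?thesis
      by (simp add: Y)
  next
    case (Z p)
    have "precedes (Z p) (X i j)" "precedes (Z p) (Y j k)"
      using assms(4-6) xy Z by auto
    with \<open>i < j\<close> \<open>j < k\<close> have "precedes (Z p) (Y i k)"
      by - (rule position_among_three[OF \<open>i < j\<close> \<open>j < k\<close>, of p]; simp add: precedes_simps)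
    then show ?thesis
      by (simp add: Z)
  qed
  then show ?thesis
    using assms(2,3,5,6) xy by auto
next
  case (yx_end i j k)
  have "precedes c (Y i j)"
  proof (cases c)
    case (X p q)
    have "p < q" "precedes (X p q) (X j k)" "precedes (X p q) (Y i k)"
      using assms(4-6) yx_end X by auto
    with \<open>i < j\<close> \<open>j < k\<close> have "precedes (X p q) (Y i j)"
      by - (rule position_among_three[OF \<open>i < j\<close> \<open>j < k\<close>, of p];
        rule position_among_three[OF \<open>i < j\<close> \<open>j < k\<close>, of q]; simp add: precedes_simps)
    then show ?thesis
      by (simp add: X)
  next
    case (Y p q)
    have "p < q" "precedes (Y p q) (X j k)" "precedes (Y p q) (Y i k)"
      using assms(4-6) yx_end Y by auto
    with \<open>i < j\<close> \<open>j < k\<close> have "precedes (Y p q) (Y i j)"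
      by - (rule position_among_three[OF \<open>i < j\<close> \<open>j < k\<close>, of p];
        rule position_among_three[OF \<open>i < j\<close> \<open>j < k\<close>, of q]; simp add: precedes_simps)
    then show ?thesis
      by (simp add: Y)
  next
    case (Z p)
    have "precedes (Z p) (X j k)" "precedes (Z p) (Y i k)"
      using assms(4-6) yx_end Z by auto
    with \<open>i < j\<close> \<open>j < k\<close> have "precedes (Z p) (Y i j)"
      by - (rule position_among_three[OF \<open>i < j\<close> \<open>j < k\<close>, of p]; simp add: precedes_simps)
    then show ?thesis
      by (simp add: Z)
  qed
  then show ?thesis
    using assms(2,3,5,6) yx_end by auto
next
  case (xz i j)
  have "precedes c (Z i) \<and> precedes c (Y i j)"
  proof (cases c)
    case (X p q)
    have "p < q" "precedes (X p q) (X i j)" "precedes (X p q) (Z j)"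
      using assms(4-6) xz X by auto
    with \<open>i < j\<close> have "precedes (X p q) (Z i) \<and> precedes (X p q) (Y i j)"
      by - (rule position_among_two[OF \<open>i < j\<close>, of p];
        rule position_among_two[OF \<open>i < j\<close>, of q]; simp add: precedes_simps)
    then show ?thesis
      by (simp add: X)
  next
    case (Y p q)
    have "p < q" "precedes (Y p q) (X i j)" "precedes (Y p q) (Z j)"
      using assms(4-6) xz Y by auto
    with \<open>i < j\<close> have "precedes (Y p q) (Z i) \<and> precedes (Y p q) (Y i j)"
      by - (rule position_among_two[OF \<open>i < j\<close>, of p];
        rule position_among_two[OF \<open>i < j\<close>, of q]; simp add: precedes_simps)
    then show ?thesis
      by (simp add: Y)
  next
    case (Z p)
    have "precedes (Z p) (X i j)" "precedes (Z p) (Z j)"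
      using assms(4-6) xz Z by auto
    with \<open>i < j\<close> have "precedes (Z p) (Z i) \<and> precedes (Z p) (Y i j)"
      by - (rule position_among_two[OF \<open>i < j\<close>, of p]; simp add: precedes_simps)
    then show ?thesis
      by (simp add: Z)
  qed
  then show ?thesis
    using assms(2,3,5,6) xz by auto
qed

lemma expansion_precedes_right:
  assumes "expansion n a b rs" "t \<in> set rs" "x \<in> set t" "valid n c" "precedes a c" "precedes b c"
  shows "precedes x c"
  using assms(1)
proof cases
  case (xx i j k)
  have "precedes (X i k) c"
  proof (cases c)
    case (X p q)
    have "p < q" "precedes (X i j) (X p q)" "precedes (X j k) (X p q)"
      using assms(4-6) xx X by auto
    with \<open>i < j\<close> \<open>j < k\<close> have "precedes (X i k) (X p q)"
      by - (rule position_among_three[OF \<open>i < j\<close> \<open>j < k\<close>, of p];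
        rule position_among_three[OF \<open>i < j\<close> \<open>j < k\<close>, of q]; simp add: precedes_simps)
    then show ?thesis
      by (simp add: X)
  next
    case (Y p q)
    have "p < q" "precedes (X i j) (Y p q)" "precedes (X j k) (Y p q)"
      using assms(4-6) xx Y by auto
    with \<open>i < j\<close> \<open>j < k\<close> have "precedes (X i k) (Y p q)"
      by - (rule position_among_three[OF \<open>i < j\<close> \<open>j < k\<close>, of p];
        rule position_among_three[OF \<open>i < j\<close> \<open>j < k\<close>, of q]; simp add: precedes_simps)
    then show ?thesis
      by (simp add: Y)
  next
    case (Z p)
    have "precedes (X i j) (Z p)" "precedes (X j k) (Z p)"
      using assms(4-6) xx Z by auto
    with \<open>i < j\<close> \<open>j < k\<close> have "precedes (X i k) (Z p)"
      by - (rule position_among_three[OF \<open>i < j\<close> \<open>j < k\<close>, of p]; simp add: precedes_simps)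
    then show ?thesis
      by (simp add: Z)
  qed
  then show ?thesis
    using assms(2,3,5,6) xx by auto
next
  case (xy i j k)
  have "precedes (Y i k) c"
  proof (cases c)
    case (X p q)
    have "p < q" "precedes (X i j) (X p q)" "precedes (Y j k) (X p q)"
      using assms(4-6) xy X by auto
    with \<open>i < j\<close> \<open>j < k\<close> have "precedes (Y i k) (X p q)"
      by - (rule position_among_three[OF \<open>i < j\<close> \<open>j < k\<close>, of p];
        rule position_among_three[OF \<open>i < j\<close> \<open>j < k\<close>, of q]; simp add: precedes_simps)
    then show ?thesis
      by (simp add: X)
  next
    case (Y p q)
    have "p < q" "precedes (X i j) (Y p q)" "precedes (Y j k) (Y p q)"
      using assms(4-6) xy Y by auto
    with \<open>i < j\<close> \<open>j < k\<close> have "precedes (Y i k) (Y p q)"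
      by - (rule position_among_three[OF \<open>i < j\<close> \<open>j < k\<close>, of p];
        rule position_among_three[OF \<open>i < j\<close> \<open>j < k\<close>, of q]; simp add: precedes_simps)
    then show ?thesis
      by (simp add: Y)
  next
    case (Z p)
    have "precedes (X i j) (Z p)" "precedes (Y j k) (Z p)"
      using assms(4-6) xy Z by auto
    with \<open>i < j\<close> \<open>j < k\<close> have "precedes (Y i k) (Z p)"
      by - (rule position_among_three[OF \<open>i < j\<close> \<open>j < k\<close>, of p]; simp add: precedes_simps)
    then show ?thesis
      by (simp add: Z)
  qed
  then show ?thesis
    using assms(2,3,5,6) xy by auto
next
  case (yx_end i j k)
  have "precedes (Y i j) c"
  proof (cases c)
    case (X p q)
    have "p < q" "precedes (X j k) (X p q)" "precedes (Y i k) (X p q)"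
      using assms(4-6) yx_end X by auto
    with \<open>i < j\<close> \<open>j < k\<close> have "precedes (Y i j) (X p q)"
      by - (rule position_among_three[OF \<open>i < j\<close> \<open>j < k\<close>, of p];
        rule position_among_three[OF \<open>i < j\<close> \<open>j < k\<close>, of q]; simp add: precedes_simps)
    then show ?thesis
      by (simp add: X)
  next
    case (Y p q)
    have "p < q" "precedes (X j k) (Y p q)" "precedes (Y i k) (Y p q)"
      using assms(4-6) yx_end Y by auto
    with \<open>i < j\<close> \<open>j < k\<close> have "precedes (Y i j) (Y p q)"
      by - (rule position_among_three[OF \<open>i < j\<close> \<open>j < k\<close>, of p];
        rule position_among_three[OF \<open>i < j\<close> \<open>j < k\<close>, of q]; simp add: precedes_simps)
    then show ?thesis
      by (simp add: Y)
  next
    case (Z p)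
    have "precedes (X j k) (Z p)" "precedes (Y i k) (Z p)"
      using assms(4-6) yx_end Z by auto
    with \<open>i < j\<close> \<open>j < k\<close> have "precedes (Y i j) (Z p)"
      by - (rule position_among_three[OF \<open>i < j\<close> \<open>j < k\<close>, of p]; simp add: precedes_simps)
    then show ?thesis
      by (simp add: Z)
  qed
  then show ?thesis
    using assms(2,3,5,6) yx_end by auto
next
  case (xz i j)
  have "precedes (Z i) c \<and> precedes (Y i j) c"
  proof (cases c)
    case (X p q)
    have "p < q" "precedes (X i j) (X p q)" "precedes (Z j) (X p q)"
      using assms(4-6) xz X by auto
    with \<open>i < j\<close> have "precedes (Z i) (X p q) \<and> precedes (Y i j) (X p q)"
      by - (rule position_among_two[OF \<open>i < j\<close>, of p];
        rule position_among_two[OF \<open>i < j\<close>, of q]; simp add: precedes_simps)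
    then show ?thesis
      by (simp add: X)
  next
    case (Y p q)
    have "p < q" "precedes (X i j) (Y p q)" "precedes (Z j) (Y p q)"
      using assms(4-6) xz Y by auto
    with \<open>i < j\<close> have "precedes (Z i) (Y p q) \<and> precedes (Y i j) (Y p q)"
      by - (rule position_among_two[OF \<open>i < j\<close>, of p];
        rule position_among_two[OF \<open>i < j\<close>, of q]; simp add: precedes_simps)
    then show ?thesis
      by (simp add: Y)
  next
    case (Z p)
    have "precedes (X i j) (Z p)" "precedes (Z j) (Z p)"
      using assms(4-6) xz Z by auto
    with \<open>i < j\<close> have "precedes (Z i) (Z p) \<and> precedes (Y i j) (Z p)"
      by - (rule position_among_two[OF \<open>i < j\<close>, of p]; simp add: precedes_simps)
    then show ?thesis
      by (simp add: Z)
  qed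
  then show ?thesis
    using assms(2,3,5,6) xz by auto
qed

lemma sorted_wrt_expansion:
  assumes "sorted_wrt precedes (u @ [a, b] @ v)" "expansion n a b rs" "t \<in> set rs"
    "\<forall>x \<in> set (u @ v). valid n x"
  shows "sorted_wrt precedes (u @ t @ v)"
proof -
  have "precedes c x" if "c \<in> set u" "x \<in> set t" for c x
    using expansion_precedes_left[OF assms(2,3)] assms(1,4) that
    by (simp add: sorted_wrt_append)
  moreover have "precedes x c" if "c \<in> set v" "x \<in> set t" for c x
    using expansion_precedes_right[OF assms(2,3)] assms(1,4) that
    by (simp add: sorted_wrt_append)
  ultimately show ?thesis
    using assms(1) expansion_sorted[OF assms(2,3)]
    by (simp add: sorted_wrt_append) blast
qed

section \<open>Weightings and forests\<close>

fun vec :: "letter \<Rightarrow> nat \<Rightarrow> int" where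
  "vec (X i j) v = of_bool (v = i) - of_bool (v = j)"
| "vec (Y i j) v = of_bool (v = i) + of_bool (v = j)"
| "vec (Z i) v = of_bool (v = i)"

definition wsum :: "(letter \<Rightarrow> nat) \<Rightarrow> letter set \<Rightarrow> nat \<Rightarrow> int" where
  "wsum f A v = (\<Sum>a\<in>A. int (f a) * vec a v)"

lemma wsum_insert: "finite B \<Longrightarrow> a \<notin> B \<Longrightarrow> wsum f (insert a B) v = int (f a) * vec a v + wsum f B v"
  by (simp add: wsum_def)

lemma wsum_fun_upd: "a \<notin> B \<Longrightarrow> wsum (f(a := k)) B v = wsum f B v"
  unfolding wsum_def by (intro sum.cong) auto

text \<open>Positivity on \<open>A\<close> makes the cone open; vanishing off \<open>A\<close> makes
  each choice of weights a single function, so that \<open>card\<close> counts the choices.\<close>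

definition weightings :: "(nat \<Rightarrow> int) \<Rightarrow> letter set \<Rightarrow> (letter \<Rightarrow> nat) set" where
  "weightings p A = {f. (\<forall>a. 0 < f a \<longleftrightarrow> a \<in> A) \<and> (\<forall>v. wsum f A v = p v)}"

lemma weightings_pos: "f \<in> weightings p A \<Longrightarrow> 0 < f a \<longleftrightarrow> a \<in> A"
  by (simp add: weightings_def)

lemma weightings_zero: "f \<in> weightings p A \<Longrightarrow> a \<notin> A \<Longrightarrow> f a = 0"
  using weightings_pos[of f p A a] by simp

lemma weightings_wsum: "f \<in> weightings p A \<Longrightarrow> wsum f A v = p v"
  by (simp add: weightings_def)

text \<open>Comparing the weights of \<open>a\<close> and \<open>b\<close> cuts the open cone over \<open>a, b\<close> into the open cones
  over \<open>c, a\<close> and \<open>b, c\<close> and the open ray through \<open>c = a + b\<close>.\<close>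

context
  fixes a b c :: letter and B :: "letter set" and p :: "nat \<Rightarrow> int"
  assumes fin: "finite B"
    and notin: "a \<notin> B" "b \<notin> B" "c \<notin> B"
    and ne: "a \<noteq> b" "c \<noteq> a" "c \<noteq> b"
    and sum: "\<And>v. vec c v = vec a v + vec b v"
begin

lemma weightings_greater:
  "bij_betw (\<lambda>f. f(a := f a - f b, b := 0, c := f b)) {f \<in> weightings p (insert a (insert b B)). f b < f a} (weightings p (insert c (insert a B)))"
proof (rule bij_betw_byWitness[where f' = "\<lambda>f. f(a := f a + f c, b := f c, c := 0)"])
  show "\<forall>f\<in>{f \<in> weightings p (insert a (insert b B)). f b < f a}. (\<lambda>f. f(a := f a + f c, b := f c, c := 0)) (f(a := f a - f b, b := 0, c := f b)) = f"
    using notin ne by (auto simp: fun_eq_iff dest: weightings_zero)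
  show "\<forall>f\<in>weightings p (insert c (insert a B)). (\<lambda>f. f(a := f a - f b, b := 0, c := f b)) (f(a := f a + f c, b := f c, c := 0)) = f"
    using notin ne by (auto simp: fun_eq_iff dest: weightings_zero)
  show "(\<lambda>f. f(a := f a - f b, b := 0, c := f b)) ` {f \<in> weightings p (insert a (insert b B)). f b < f a} \<subseteq> weightings p (insert c (insert a B))"
  proof clarify
    fix f assume f: "f \<in> weightings p (insert a (insert b B))" "f b < f a"
    have "wsum (f(a := f a - f b, b := 0, c := f b)) (insert c (insert a B)) v = p v" for v
      using weightings_wsum[OF f(1), of v] f(2) notin ne fin
      by (simp add: wsum_insert wsum_fun_upd sum of_nat_diff algebra_simps)
    then show "f(a := f a - f b, b := 0, c := f b) \<in> weightings p (insert c (insert a B))"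
      using weightings_pos[OF f(1)] f(2) notin ne by (auto simp: weightings_def)
  qed
  show "(\<lambda>f. f(a := f a + f c, b := f c, c := 0)) ` weightings p (insert c (insert a B)) \<subseteq> {f \<in> weightings p (insert a (insert b B)). f b < f a}"
  proof clarify
    fix f assume f: "f \<in> weightings p (insert c (insert a B))"
    let ?g = "f(a := f a + f c, b := f c, c := 0)"
    have "wsum ?g (insert a (insert b B)) v = p v" for v
      using weightings_wsum[OF f, of v] notin ne fin
      by (simp add: wsum_insert wsum_fun_upd sum algebra_simps)
    then show "?g \<in> weightings p (insert a (insert b B)) \<and> ?g b < ?g a"
      using weightings_pos[OF f] notin ne by (auto simp: weightings_def)
  qed
qed

lemma weightings_less:
  "bij_betw (\<lambda>f. f(a := 0, b := f b - f a, c := f a)) {f \<in> weightings p (insert a (insert b B)). f a < f b} (weightings p (insert b (insert c B)))"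
proof (rule bij_betw_byWitness[where f' = "\<lambda>f. f(a := f c, b := f b + f c, c := 0)"])
  show "\<forall>f\<in>{f \<in> weightings p (insert a (insert b B)). f a < f b}. (\<lambda>f. f(a := f c, b := f b + f c, c := 0)) (f(a := 0, b := f b - f a, c := f a)) = f"
    using notin ne by (auto simp: fun_eq_iff dest: weightings_zero)
  show "\<forall>f\<in>weightings p (insert b (insert c B)). (\<lambda>f. f(a := 0, b := f b - f a, c := f a)) (f(a := f c, b := f b + f c, c := 0)) = f"
    using notin ne by (auto simp: fun_eq_iff dest: weightings_zero)
  show "(\<lambda>f. f(a := 0, b := f b - f a, c := f a)) ` {f \<in> weightings p (insert a (insert b B)). f a < f b} \<subseteq> weightings p (insert b (insert c B))"
  proof clarify
    fix f assume f: "f \<in> weightings p (insert a (insert b B))" "f a < f b"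
    have "wsum (f(a := 0, b := f b - f a, c := f a)) (insert b (insert c B)) v = p v" for v
      using weightings_wsum[OF f(1), of v] f(2) notin ne fin
      by (simp add: wsum_insert wsum_fun_upd sum of_nat_diff algebra_simps)
    then show "f(a := 0, b := f b - f a, c := f a) \<in> weightings p (insert b (insert c B))"
      using weightings_pos[OF f(1)] f(2) notin ne by (auto simp: weightings_def)
  qed
  show "(\<lambda>f. f(a := f c, b := f b + f c, c := 0)) ` weightings p (insert b (insert c B)) \<subseteq> {f \<in> weightings p (insert a (insert b B)). f a < f b}"
  proof clarify
    fix f assume f: "f \<in> weightings p (insert b (insert c B))"
    let ?g = "f(a := f c, b := f b + f c, c := 0)"
    have "wsum ?g (insert a (insert b B)) v = p v" for v
      using weightings_wsum[OF f, of v] notin ne fin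
      by (simp add: wsum_insert wsum_fun_upd sum algebra_simps)
    then show "?g \<in> weightings p (insert a (insert b B)) \<and> ?g a < ?g b"
      using weightings_pos[OF f] notin ne by (auto simp: weightings_def)
  qed
qed

lemma weightings_equal:
  "bij_betw (\<lambda>f. f(a := 0, b := 0, c := f a)) {f \<in> weightings p (insert a (insert b B)). f a = f b} (weightings p (insert c B))"
proof (rule bij_betw_byWitness[where f' = "\<lambda>f. f(a := f c, b := f c, c := 0)"])
  show "\<forall>f\<in>{f \<in> weightings p (insert a (insert b B)). f a = f b}. (\<lambda>f. f(a := f c, b := f c, c := 0)) (f(a := 0, b := 0, c := f a)) = f"
    using notin ne by (auto simp: fun_eq_iff dest: weightings_zero)
  show "\<forall>f\<in>weightings p (insert c B). (\<lambda>f. f(a := 0, b := 0, c := f a)) (f(a := f c, b := f c, c := 0)) = f"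
    using notin ne by (auto simp: fun_eq_iff dest: weightings_zero)
  show "(\<lambda>f. f(a := 0, b := 0, c := f a)) ` {f \<in> weightings p (insert a (insert b B)). f a = f b} \<subseteq> weightings p (insert c B)"
  proof clarify
    fix f assume f: "f \<in> weightings p (insert a (insert b B))" "f a = f b"
    have "wsum (f(a := 0, b := 0, c := f a)) (insert c B) v = p v" for v
      using weightings_wsum[OF f(1), of v] f(2) notin ne fin
      by (simp add: wsum_insert wsum_fun_upd sum of_nat_diff algebra_simps)
    then show "f(a := 0, b := 0, c := f a) \<in> weightings p (insert c B)"
      using weightings_pos[OF f(1)] f(2) notin ne by (auto simp: weightings_def)
  qed
  show "(\<lambda>f. f(a := f c, b := f c, c := 0)) ` weightings p (insert c B) \<subseteq> {f \<in> weightings p (insert a (insert b B)). f a = f b}"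
  proof clarify
    fix f assume f: "f \<in> weightings p (insert c B)"
    let ?g = "f(a := f c, b := f c, c := 0)"
    have "wsum ?g (insert a (insert b B)) v = p v" for v
      using weightings_wsum[OF f, of v] notin ne fin
      by (simp add: wsum_insert wsum_fun_upd sum algebra_simps)
    then show "?g \<in> weightings p (insert a (insert b B)) \<and> ?g a = ?g b"
      using weightings_pos[OF f] notin ne by (auto simp: weightings_def)
  qed
qed

lemma weightings_split:
  assumes "finite (weightings p (insert a (insert b B)))"
  shows "finite (weightings p (insert c (insert a B)))"
    "finite (weightings p (insert b (insert c B)))"
    "finite (weightings p (insert c B))"
    "card (weightings p (insert a (insert b B))) = card (weightings p (insert c (insert a B))) +
      card (weightings p (insert b (insert c B))) + card (weightings p (insert c B))"
proof -
  let ?W = "weightings p (insert a (insert b B))"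
  have "?W = {f \<in> ?W. f b < f a} \<union> {f \<in> ?W. f a < f b} \<union> {f \<in> ?W. f a = f b}"
    by auto
  then have "card ?W = card ({f \<in> ?W. f b < f a} \<union> {f \<in> ?W. f a < f b} \<union> {f \<in> ?W. f a = f b})"
    by simp
  also have "\<dots> = card {f \<in> ?W. f b < f a} + card {f \<in> ?W. f a < f b} + card {f \<in> ?W. f a = f b}"
    using assms by (subst card_Un_disjoint; (subst card_Un_disjoint)?) auto
  finally show "card ?W = card (weightings p (insert c (insert a B))) +
      card (weightings p (insert b (insert c B))) + card (weightings p (insert c B))"
    using bij_betw_same_card[OF weightings_greater] bij_betw_same_card[OF weightings_less]
      bij_betw_same_card[OF weightings_equal] by simp
  show "finite (weightings p (insert c (insert a B)))"
    "finite (weightings p (insert b (insert c B)))"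
    "finite (weightings p (insert c B))"
    using assms bij_betw_finite[OF weightings_greater] bij_betw_finite[OF weightings_less]
      bij_betw_finite[OF weightings_equal] by auto
qed

end

text \<open>Finiteness travels with the count because \<open>card\<close> is additive only on finite
  sets. The letters of each right-hand side avoid \<open>B\<close>, so every union below stands for
  a word without repetitions.\<close>

lemma weightings_expansion:
  assumes "expansion n a b rs" "finite B" "a \<notin> B" "b \<notin> B"
    and "\<And>t x. t \<in> set rs \<Longrightarrow> x \<in> set t \<Longrightarrow> x \<notin> B"
    and "finite (weightings p ({a, b} \<union> B))"
  shows "(\<forall>t \<in> set rs. finite (weightings p (set t \<union> B))) \<and>
    card (weightings p ({a, b} \<union> B)) = (\<Sum>t\<leftarrow>rs. card (weightings p (set t \<union> B)))"
  using assms(1)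
proof cases
  case (xx i j k)
  have "X i k \<notin> B"
    using assms(5)[of "[X i k]"] xx by simp
  then show ?thesis
    using weightings_split[of B a b "X i k" p] assms(2-4,6) xx by (simp add: insert_commute)
next
  case (xy i j k)
  have "Y i k \<notin> B"
    using assms(5)[of "[Y i k]"] xy by simp
  then show ?thesis
    using weightings_split[of B a b "Y i k" p] assms(2-4,6) xy by (simp add: insert_commute)
next
  case (yx_end i j k)
  have "Y i j \<notin> B"
    using assms(5)[of "[Y i j]"] yx_end by simp
  then show ?thesis
    using weightings_split[of B a b "Y i j" p] assms(2-4,6) yx_end by (simp add: insert_commute)
next
  case (xz i j)
  have "Z i \<notin> B" "Y i j \<notin> B"
    using assms(5)[of "[Z i]"] assms(5)[of "[Y i j]"] xz by simp_all
  then show ?thesis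
    \<comment> \<open>Two cuts give the five terms: the cone over \<open>X i j\<close>,
      \<open>Z j\<close> is cut along \<open>Z i\<close>, and its piece over \<open>Z j\<close>,
      \<open>Z i\<close> is cut along \<open>Y i j\<close>.\<close>
    using weightings_split[of B a b "Z i" p] weightings_split[of B "Z j" "Z i" "Y i j" p] assms(2-4,6) xz
    by (simp add: insert_commute)
qed

text \<open>Over the field with two elements the edges \<open>e\<^sub>i + e\<^sub>j\<close> of a graph are linearly independent if and
  only if it is a forest. The definition is the dual form of this condition: a linear functional
  can take prescribed values on them.\<close>

fun edge_parity :: "(nat \<Rightarrow> bool) \<Rightarrow> letter \<Rightarrow> bool" where
  "edge_parity f (X i j) \<longleftrightarrow> f i \<noteq> f j"
| "edge_parity f (Y i j) \<longleftrightarrow> f i \<noteq> f j"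
| "edge_parity f (Z i) \<longleftrightarrow> False"

fun is_loop :: "letter \<Rightarrow> bool" where
  "is_loop (Z i) = True" | "is_loop _ = False"

definition forest :: "letter set \<Rightarrow> bool" where
  "forest A \<longleftrightarrow> (\<forall>t. \<exists>f. \<forall>a\<in>A. is_loop a \<or> edge_parity f a = t a)"

lemma forestD: "forest A \<Longrightarrow> \<exists>f. \<forall>a\<in>A. is_loop a \<or> edge_parity f a = t a"
  unfolding forest_def by (erule spec)

lemma forestI:
  assumes "\<And>t. \<exists>f. \<forall>a\<in>A. is_loop a \<or> edge_parity f a = t a"
  shows "forest A"
  unfolding forest_def by (rule allI, rule assms)

lemma forest_mono:
  assumes "forest A" "B \<subseteq> A"
  shows "forest B"
proof (rule forestI)
  fix t
  obtain f where f: "\<forall>a\<in>A. is_loop a \<or> edge_parity f a = t a"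
    using forestD[OF assms(1), of t] by (elim exE)
  show "\<exists>f. \<forall>a\<in>B. is_loop a \<or> edge_parity f a = t a"
    using f assms(2) by (intro exI[of _ f]) auto
qed

text \<open>Modulo 2 the edge \<open>c\<close> is the sum of \<open>a\<close> and \<open>b\<close>,
  so exchanging \<open>b\<close> for \<open>c\<close> is a change of basis. To get the value
  \<open>t c\<close> on \<open>c\<close>, the functional is asked for \<open>t a + t c\<close> on
  \<open>b\<close>.\<close>

lemma forest_replace:
  assumes "forest (insert a (insert b B))" "a \<notin> B" "b \<notin> B" "a \<noteq> b"
    "\<not> is_loop a" "\<not> is_loop b" "\<And>f. edge_parity f c \<longleftrightarrow> edge_parity f a \<noteq> edge_parity f b"
  shows "forest (insert c (insert a B))"
proof (rule forestI)
  fix t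
  obtain f where "\<forall>x \<in> insert a (insert b B). is_loop x \<or> edge_parity f x = (t(b := (t a \<noteq> t c))) x"
    using forestD[OF assms(1), of "t(b := (t a \<noteq> t c))"] by (elim exE)
  then have f: "is_loop x \<or> edge_parity f x = (t(b := (t a \<noteq> t c))) x"
    if "x \<in> insert a (insert b B)" for x
    using that by (rule bspec)
  have "is_loop x \<or> edge_parity f x = t x" if "x \<in> insert c (insert a B)" for x
  proof (cases "x = c")
    case True
    have "edge_parity f a = t a" "edge_parity f b = (t a \<noteq> t c)"
      using f[of a] f[of b] assms(4-6) by auto
    then show ?thesis
      using True assms(7) by auto
  next
    case False
    then have "x \<noteq> b" "x \<in> insert a (insert b B)"
      using that assms(3,4) by auto
    then show ?thesis
      using f[of x] by simp
  qed
  then show "\<exists>f. \<forall>x\<in>insert c (insert a B). is_loop x \<or> edge_parity f x = t x"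
    by (intro exI[of _ f]) simp
qed

lemma forest_expansion:
  assumes "expansion n a b rs" "a \<notin> B" "b \<notin> B" "forest ({a, b} \<union> B)" "t \<in> set rs"
  shows "forest (set t \<union> B)"
  using assms(1)
proof cases
  case (xx i j k)
  have "forest (insert (X i k) (insert a B))" "forest (insert (X i k) (insert b B))"
    using forest_replace[of a b B "X i k"] forest_replace[of b a B "X i k"] assms xx
    by (auto simp: insert_commute)
  then show ?thesis
    using assms(5) xx by (auto simp: insert_commute intro: forest_mono)
next
  case (xy i j k)
  have "forest (insert (Y i k) (insert a B))" "forest (insert (Y i k) (insert b B))"
    using forest_replace[of a b B "Y i k"] forest_replace[of b a B "Y i k"] assms xy
    by (auto simp: insert_commute)
  then show ?thesis
    using assms(5) xy by (auto simp: insert_commute intro: forest_mono)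
next
  case (yx_end i j k)
  have "forest (insert (Y i j) (insert a B))" "forest (insert (Y i j) (insert b B))"
    using forest_replace[of a b B "Y i j"] forest_replace[of b a B "Y i j"] assms yx_end
    by (auto simp: insert_commute)
  then show ?thesis
    using assms(5) yx_end by (auto simp: insert_commute intro: forest_mono)
next
  case (xz i j)
  have "\<exists>f. \<forall>x\<in>set t \<union> B. is_loop x \<or> edge_parity f x = s x" for s
  proof -
    \<comment> \<open>\<open>X i j\<close> and \<open>Y i j\<close> have the same parity and never
      occur together in \<open>t\<close>, so the value wanted for whichever occurs is prescribed on
      \<open>X i j\<close>.\<close>
    let ?y = "if Y i j \<in> set t then Y i j else X i j"
    obtain f where "\<forall>x \<in> {a, b} \<union> B. is_loop x \<or> edge_parity f x = (s(X i j := s ?y)) x"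
      using forestD[OF assms(4), of "s(X i j := s ?y)"] by (elim exE)
    then have f: "is_loop x \<or> edge_parity f x = (s(X i j := s ?y)) x" if "x \<in> {a, b} \<union> B" for x
      using that by (rule bspec)
    have "is_loop x \<or> edge_parity f x = s x" if "x \<in> set t \<union> B" for x
      using f[of x] f[of a] that assms xz by (auto split: if_splits)
    then show ?thesis
      by (intro exI[of _ f]) simp
  qed
  then show ?thesis
    by (rule forestI)
qed

section \<open>Invariance under reduction\<close>

lemma precedes_commute: "vertex_disjoint a b \<Longrightarrow> precedes a b \<Longrightarrow> precedes b a"
  using compatible_sym vertex_disjoint_sym unfolding precedes_def by blast

lemma sorted_wrt_commute_step:
  assumes "commute_step u v" "sorted_wrt precedes u"
  shows "sorted_wrt precedes v"
  using assms
  by (induction rule: commute_step.induct)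
    (auto simp: sorted_wrt_append vertex_disjoint_iff intro: precedes_commute)

lemma commute_eq_invariant:
  assumes "\<And>u v. commute_step u v \<Longrightarrow> f u = f v" "commute_eq u v"
  shows "f u = f v"
  using assms(2) unfolding commute_eq_def
  by (induction rule: rtranclp_induct) (auto dest: assms(1))

lift_definition letters :: "monomial \<Rightarrow> letter set" is set
  by (erule commute_eq_invariant[rotated]) (auto elim: commute_step.cases)

lift_definition total_degree :: "monomial \<Rightarrow> nat" is length
  by (erule commute_eq_invariant[rotated]) (auto elim: commute_step.cases)

lift_definition well_ordered :: "monomial \<Rightarrow> bool" is "sorted_wrt precedes"
  by (erule commute_eq_invariant[rotated]) (blast intro: sorted_wrt_commute_step commute_step_sym)

lemmas monomial_simps =
  letters.abs_eq total_degree.abs_eq well_ordered.abs_eq letter_monomial.abs_eq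
  plus_monomial.abs_eq zero_monomial_def

lemma monomial_word:
  obtains w where "m = abs_monomial w"
proof -
  have "\<exists>w. m = abs_monomial w"
    by (induction m rule: monomial.abs_induct) auto
  then show thesis
    using that by auto
qed

lemma abs_monomial_eqI: "commute_eq u v \<Longrightarrow> abs_monomial u = abs_monomial v"
  by (simp add: monomial.abs_eq_iff)

text \<open>The invariant of all monomials reached from \<open>w_C\<close>. The order limits the
  rules that can apply, the forest condition excludes cycles in the final graphs, and finiteness
  keeps the counts additive.\<close>

definition good :: "nat \<Rightarrow> monomial \<Rightarrow> bool" where
  "good n m \<longleftrightarrow> well_ordered m \<and> (\<forall>a \<in> letters m. valid n a) \<and> forest (letters m) \<and>
    (\<forall>p. finite (weightings p (letters m)))"

section \<open>Linear functionals on polynomials and their invariance\<close>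

definition linear_extension :: "(monomial \<Rightarrow> rat poly) \<Rightarrow> ncpoly \<Rightarrow> rat poly" where
  "linear_extension g P = (\<Sum>m\<in>Poly_Mapping.keys P. Poly_Mapping.lookup P m * g m)"

lemma linear_extension_superset:
  assumes "finite S" "Poly_Mapping.keys P \<subseteq> S"
  shows "linear_extension g P = (\<Sum>m\<in>S. Poly_Mapping.lookup P m * g m)"
  unfolding linear_extension_def
  using assms by (intro sum.mono_neutral_left) (auto simp: in_keys_iff)

lemma linear_extension_add: "linear_extension g (P + Q) = linear_extension g P + linear_extension g Q"
proof -
  let ?S = "Poly_Mapping.keys P \<union> Poly_Mapping.keys Q"
  have "finite ?S" "Poly_Mapping.keys (P + Q) \<subseteq> ?S"
    by (auto dest: subsetD[OF Poly_Mapping.keys_add])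
  then show ?thesis
    using linear_extension_superset[of ?S P g] linear_extension_superset[of ?S Q g]
      linear_extension_superset[of ?S "P + Q" g]
    by (simp add: lookup_add distrib_right sum.distrib)
qed

lemma linear_extension_single [simp]: "linear_extension g (Poly_Mapping.single m c) = c * g m"
  by (simp add: linear_extension_def)

lemma linear_extension_0 [simp]: "linear_extension g 0 = 0"
  by (simp add: linear_extension_def)

lemma linear_extension_diff: "linear_extension g (P - Q) = linear_extension g P - linear_extension g Q"
  using linear_extension_add[of g "P - Q" Q] by simp

lemma linear_extension_sum_list:
  "linear_extension g (sum_list Ps) = sum_list (map (linear_extension g) Ps)"
  by (induction Ps) (simp_all add: linear_extension_add)

text \<open>A term that has lost a letter carries one more factor \<beta>; taking the degree as the
  exponent makes both kinds of terms contribute the same power.\<close>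

definition weighting_count :: "(nat \<Rightarrow> int) \<Rightarrow> monomial \<Rightarrow> rat poly" where
  "weighting_count p m = monom (of_nat (card (weightings p (letters m)))) (total_degree m)"

definition word_poly :: "nat \<Rightarrow> letter list \<Rightarrow> ncpoly" where
  "word_poly k w = Poly_Mapping.single (abs_monomial w) (monom 1 k)"

lemma var_word_poly: "var a = word_poly 0 [a]"
  by (simp add: var_def word_poly_def letter_monomial.abs_eq)

lemma beta_word_poly: "\<beta> = word_poly 1 []"
  by (simp add: beta_def word_poly_def zero_monomial_def monom_altdef)

lemma word_poly_mult: "word_poly k u * word_poly l v = word_poly (k + l) (u @ v)"
  by (simp add: word_poly_def mult_single mult_monom plus_monomial.abs_eq)

text \<open>The rules are homogeneous if \<beta> counts as one letter, so the power of \<beta> is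
  the number of letters missing from \<open>t\<close>.\<close>

definition expansion_poly :: "letter list list \<Rightarrow> ncpoly" where
  "expansion_poly rs = (\<Sum>t\<leftarrow>rs. word_poly (2 - length t) t)"

lemma bracket_rule_expansion:
  assumes "bracket_rule n a b r" "precedes a b"
  shows "\<exists>rs. expansion n a b rs \<and> r = expansion_poly rs"
  using assms(1)
proof cases
  case (x_x i j k)
  then show ?thesis
    by (intro exI[of _ "[[X i k, X i j], [X j k, X i k], [X i k]]"])
      (simp add: expansion.xx expansion_poly_def var_word_poly beta_word_poly word_poly_mult add.assoc)
next
  case (x_y i j k)
  then show ?thesis
    by (intro exI[of _ "[[Y i k, X i j], [Y j k, Y i k], [Y i k]]"])
      (simp add: expansion.xy expansion_poly_def var_word_poly beta_word_poly word_poly_mult add.assoc)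
next
  case (y_x_end' i j k)
  then show ?thesis
    by (intro exI[of _ "[[Y i j, X j k], [Y i k, Y i j], [Y i j]]"])
      (simp add: expansion.yx_end expansion_poly_def var_word_poly beta_word_poly word_poly_mult add.assoc)
next
  case (x_z i j)
  then show ?thesis
    by (intro exI[of _ "[[Z i, X i j], [Y i j, Z i], [Z j, Y i j], [Z i], [Y i j]]"])
      (simp add: expansion.xz expansion_poly_def var_word_poly beta_word_poly word_poly_mult add.assoc)
qed (use assms(2) in \<open>auto simp: precedes_simps\<close>)

lemma expansion_length: "expansion n a b rs \<Longrightarrow> t \<in> set rs \<Longrightarrow> length t \<le> 2"
  by (induction rule: expansion.induct) auto

lemma sorted_wrt_precedes_distinct:
  "sorted_wrt precedes w \<Longrightarrow> \<forall>a \<in> set w. valid n a \<Longrightarrow> distinct w"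
  by (induction w) (auto dest: precedes_irrefl)

text \<open>Sorted words of valid letters have no repetitions, before and after the rewriting. This
  supplies the disjointness from \<open>B\<close> under which the set-based results on weightings
  and forests speak about words.\<close>

lemma good_expansion:
  assumes "good n (abs_monomial (u @ [a, b] @ v))" "expansion n a b rs"
  shows "\<forall>t \<in> set rs. good n (abs_monomial (u @ t @ v))"
    and "card (weightings p (letters (abs_monomial (u @ [a, b] @ v)))) =
      (\<Sum>t\<leftarrow>rs. card (weightings p (letters (abs_monomial (u @ t @ v)))))"
proof -
  let ?B = "set u \<union> set v"
  have sorted: "sorted_wrt precedes (u @ [a, b] @ v)"
    and valid: "\<forall>x \<in> set (u @ [a, b] @ v). valid n x"
    and forest: "forest (insert a (insert b ?B))"
    and finite: "\<And>p. finite (weightings p ({a, b} \<union> ?B))"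
    using assms(1) by (auto simp: good_def monomial_simps)
  have ab: "a \<notin> ?B" "b \<notin> ?B"
    using sorted_wrt_precedes_distinct[OF sorted valid] by auto
  have sorted': "sorted_wrt precedes (u @ t @ v)" and valid': "\<forall>x \<in> set (u @ t @ v). valid n x"
    if "t \<in> set rs" for t
    using sorted_wrt_expansion[OF sorted assms(2) that] expansion_valid[OF assms(2) that] valid
    by auto
  have notin: "x \<notin> ?B" if "t \<in> set rs" "x \<in> set t" for t x
    using sorted_wrt_precedes_distinct[OF sorted'[OF that(1)] valid'[OF that(1)]] that(2) by auto
  have eq: "set (u @ t @ v) = set t \<union> ?B" for t
    by auto
  have expand: "(\<forall>t \<in> set rs. finite (weightings p (set t \<union> ?B))) \<and>
      card (weightings p ({a, b} \<union> ?B)) = (\<Sum>t\<leftarrow>rs. card (weightings p (set t \<union> ?B)))" for p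
    by (rule weightings_expansion[OF assms(2) _ ab notin finite]) simp_all
  have "{a, b} \<union> ?B = set (u @ [a, b] @ v)"
    by auto
  then show "card (weightings p (letters (abs_monomial (u @ [a, b] @ v)))) =
      (\<Sum>t\<leftarrow>rs. card (weightings p (letters (abs_monomial (u @ t @ v)))))"
    using expand[of p] by (simp only: letters.abs_eq eq)
  show "\<forall>t \<in> set rs. good n (abs_monomial (u @ t @ v))"
  proof
    fix t assume t: "t \<in> set rs"
    have "forest (set t \<union> ?B)"
      by (rule forest_expansion[OF assms(2) ab _ t]) (use forest in simp)
    then show "good n (abs_monomial (u @ t @ v))"
      using sorted'[OF t] valid'[OF t] expand t
      unfolding good_def letters.abs_eq well_ordered.abs_eq eq by blast
  qed
qed

lemma reduction_step_good:
  assumes "reduction_step n P Q" "\<forall>m \<in> Poly_Mapping.keys P. good n m"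
  shows "(\<forall>m \<in> Poly_Mapping.keys Q. good n m) \<and>
    linear_extension (weighting_count p) Q = linear_extension (weighting_count p) P"
  using assms(1)
proof cases
  case (1 m u a b v r c)
  obtain u' v' where u': "u = abs_monomial u'" and v': "v = abs_monomial v'"
    using monomial_word by metis
  have m: "m = abs_monomial (u' @ [a, b] @ v')"
    using 1 u' v' by (simp add: monomial_simps)
  have good: "good n (abs_monomial (u' @ [a, b] @ v'))"
    using assms(2) 1(2) unfolding m by simp
  then have "precedes a b"
    by (simp add: good_def well_ordered.abs_eq sorted_wrt_append)
  then obtain rs where rs: "expansion n a b rs" "r = expansion_poly rs"
    using bracket_rule_expansion 1 by blast
  have "Poly_Mapping.single u c * expansion_poly ts * Poly_Mapping.single v 1 =
      (\<Sum>t\<leftarrow>ts. Poly_Mapping.single (abs_monomial (u' @ t @ v')) (c * monom 1 (2 - length t)))" for ts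
    by (induction ts)
      (simp_all add: expansion_poly_def word_poly_def u' v' mult_single plus_monomial.abs_eq algebra_simps)
  then have Q: "Q = P - Poly_Mapping.single m c +
      (\<Sum>t\<leftarrow>rs. Poly_Mapping.single (abs_monomial (u' @ t @ v')) (c * monom 1 (2 - length t)))"
    using 1 rs by simp
  have "Poly_Mapping.keys (\<Sum>t\<leftarrow>ts. Poly_Mapping.single (abs_monomial (u' @ t @ v')) (c * monom 1 (2 - length t)))
      \<subseteq> (\<lambda>t. abs_monomial (u' @ t @ v')) ` set ts" for ts
    by (induction ts) (auto dest!: subsetD[OF Poly_Mapping.keys_add] split: if_splits)
  then have "Poly_Mapping.keys Q \<subseteq> Poly_Mapping.keys P \<union> {m} \<union> (\<lambda>t. abs_monomial (u' @ t @ v')) ` set rs"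
    unfolding Q by (fastforce dest!: subsetD[OF Poly_Mapping.keys_add] subsetD[OF keys_diff] split: if_splits)
  then have "\<forall>m \<in> Poly_Mapping.keys Q. good n m"
    using assms(2) good good_expansion(1)[OF good rs(1)] m by blast
  \<comment> \<open>The powers of \<beta> add up to \<open>total_degree m\<close> for every
    \<open>t\<close>. The bound \<open>length t \<le> 2\<close> matters here, since the subtraction
    is truncated.\<close>
  moreover have "(\<Sum>t\<leftarrow>rs. c * monom 1 (2 - length t) * weighting_count p (abs_monomial (u' @ t @ v'))) =
      (\<Sum>t\<leftarrow>rs. c * monom (of_nat (card (weightings p (letters (abs_monomial (u' @ t @ v')))))) (total_degree m))"
    using expansion_length[OF rs(1)]
    by (intro arg_cong[where f = sum_list] map_cong refl)
      (simp add: weighting_count_def mult.assoc mult_monom m total_degree.abs_eq)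
  moreover have "(\<Sum>t\<leftarrow>ts. c * monom (of_nat (g t)) k) = c * monom (of_nat (\<Sum>t\<leftarrow>ts. g t)) k"
    for ts :: "letter list list" and g k
    by (induction ts) (simp_all add: add_monom[symmetric] algebra_simps)
  ultimately show ?thesis
    using good_expansion(2)[OF good rs(1), of p] unfolding Q
    by (simp add: linear_extension_add linear_extension_diff linear_extension_sum_list o_def
        weighting_count_def m)
qed

lemma reductions_good:
  assumes "(reduction_step n)\<^sup>*\<^sup>* P Q" "\<forall>m \<in> Poly_Mapping.keys P. good n m"
  shows "(\<forall>m \<in> Poly_Mapping.keys Q. good n m) \<and>
    (\<forall>p. linear_extension (weighting_count p) Q = linear_extension (weighting_count p) P)"
  using assms by (induction rule: rtranclp_induct) (use reduction_step_good in auto)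

section \<open>Irreducible monomials and uniqueness of weightings\<close>

text \<open>\<open>conflict a b\<close>: the larger endpoint of the negative edge \<open>a\<close> is incident with a positive sign to \<open>b\<close>.\<close>

fun conflict :: "letter \<Rightarrow> letter \<Rightarrow> bool" where
  "conflict (X i j) b \<longleftrightarrow> j = lo b \<or> positive b \<and> j = hi b"
| "conflict _ b \<longleftrightarrow> False"

definition alternating_letters :: "letter set \<Rightarrow> bool" where
  "alternating_letters A \<longleftrightarrow> (\<forall>a\<in>A. \<forall>b\<in>A. \<not> conflict a b)"

lemma conflict_not_precedes: "conflict a b \<Longrightarrow> precedes b a \<Longrightarrow> valid n a \<Longrightarrow> valid n b \<Longrightarrow> False"
  by (cases a; cases b) (auto simp: precedes_simps)

lemma conflict_bracket_rule:
  assumes "conflict a b" "precedes a b" "valid n a" "valid n b"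
  shows "\<exists>r. bracket_rule n a b r"
proof -
  obtain i j where a: "a = X i j"
    using assms(1) by (cases a) auto
  show ?thesis
  proof (cases b)
    case (X k l)
    then have "k = j" "1 \<le> i" "i < j" "j < l" "l \<le> n"
      using assms a by auto
    then show ?thesis
      using bracket_rule.x_x[of i j l n] a X by blast
  next
    case (Y k l)
    \<comment> \<open>If the larger endpoints agree, \<open>k < i\<close> is forced: the positive
      edge must not lie below the negative one. This is the configuration of
      \<open>y_x_end'\<close>.\<close>
    then have "j = k \<and> j < l \<or> j = l \<and> k < i" "1 \<le> i" "1 \<le> k" "i < j" "j \<le> n" "l \<le> n"
      using assms a by (auto simp: precedes_simps)
    then show ?thesis
      using bracket_rule.x_y[of i j l n] bracket_rule.y_x_end'[of k i j n] a Y by blast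
  next
    case (Z k)
    then have "k = j" "1 \<le> i" "i < j" "j \<le> n"
      using assms a by auto
    then show ?thesis
      using bracket_rule.x_z[of i j n] a Z by blast
  qed
qed

section \<open>Moving conflicting letters next to each other\<close>

lemma commute_eq_refl: "commute_eq u u"
  by (simp add: commute_eq_def)

lemma commute_eq_trans [trans]: "commute_eq u v \<Longrightarrow> commute_eq v w \<Longrightarrow> commute_eq u w"
  unfolding commute_eq_def by (rule rtranclp_trans)

lemma commute_eq_Cons: "commute_eq u v \<Longrightarrow> commute_eq (a # u) (a # v)"
  using commute_eq_context[of u v "[a]" "[]"] by simp

lemma commute_eq_swap: "vertex_disjoint a b \<Longrightarrow> commute_eq (a # b # w) (b # a # w)"
  unfolding commute_eq_def
  using commute_step.intros[of a b "[]" w] by (auto simp: vertex_disjoint_iff)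

lemma commute_eq_move:
  "\<forall>x \<in> set w. vertex_disjoint a x \<Longrightarrow> commute_eq (a # w @ v) (w @ a # v)"
proof (induction w)
  case Nil
  then show ?case
    by (simp add: commute_eq_refl)
next
  case (Cons x w)
  then have "commute_eq (a # x # w @ v) (x # a # w @ v)"
    by (intro commute_eq_swap) simp
  also have "commute_eq (x # a # w @ v) (x # w @ a # v)"
    using Cons by (intro commute_eq_Cons) simp
  finally show ?case
    by simp
qed

lemma commute_eq_partition:
  "sorted_wrt (\<lambda>c d. D c \<longrightarrow> \<not> D d \<longrightarrow> vertex_disjoint c d) w \<Longrightarrow>
    commute_eq w (filter (\<lambda>c. \<not> D c) w @ filter D w)"
proof (induction w)
  case Nil
  then show ?case
    by (simp add: commute_eq_refl)
next
  case (Cons c w)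
  then have "commute_eq (c # w) (c # filter (\<lambda>c. \<not> D c) w @ filter D w)"
    by (intro commute_eq_Cons) simp
  also have "commute_eq \<dots> (filter (\<lambda>c. \<not> D c) (c # w) @ filter D (c # w))"
    using Cons.prems by (auto intro!: commute_eq_move simp: commute_eq_refl)
  finally show ?case .
qed

text \<open>The letters between \<open>a\<close> and \<open>b\<close> are cleared away in both
  directions: those outside \<open>D\<close> move to the front and then past \<open>a\<close>, those
  in \<open>D\<close> move past \<open>b\<close>.\<close>

lemma commute_eq_adjacent:
  assumes "sorted_wrt (\<lambda>c d. D c \<longrightarrow> \<not> D d \<longrightarrow> vertex_disjoint c d) w"
    and "\<And>c. c \<in> set w \<Longrightarrow> \<not> D c \<Longrightarrow> vertex_disjoint a c"
    and "\<And>c. c \<in> set w \<Longrightarrow> D c \<Longrightarrow> vertex_disjoint c b"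
  shows "\<exists>u v. commute_eq (a # w @ [b]) (u @ [a, b] @ v)"
proof -
  let ?F = "filter (\<lambda>c. \<not> D c) w" and ?G = "filter D w"
  have "commute_eq (a # w @ [b]) (a # (?F @ ?G) @ [b])"
    using commute_eq_context[OF commute_eq_partition[OF assms(1)], of "[a]" "[b]"] by simp
  also have "commute_eq \<dots> (?F @ a # ?G @ [b])"
    using commute_eq_move[of ?F a "?G @ [b]"] assms(2) by simp
  also have "commute_eq \<dots> ((?F @ [a]) @ (b # ?G) @ [])"
  proof -
    have "commute_eq (?G @ [b]) (b # ?G)"
      using commute_eq_move[of ?G b "[]"] assms(3) by (auto intro: commute_eq_sym vertex_disjoint_sym)
    then show ?thesis
      using commute_eq_context[of "?G @ [b]" "b # ?G" "?F @ [a]" "[]"] by simp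
  qed
  finally have "commute_eq (a # w @ [b]) (?F @ [a, b] @ ?G)"
    by simp
  then show ?thesis
    by blast
qed

text \<open>The given pair need not be movable, so an extremal one is chosen: \<open>a\<close> is
  the last letter that conflicts with anything, and \<open>b\<close> is the first later letter in
  conflict with it. The set \<open>D\<close> consists of the letters that share a vertex with
  \<open>a\<close>.\<close>

lemma adjacent_conflict:
  assumes "sorted_wrt precedes w" "\<forall>a \<in> set w. valid n a" "a \<in> set w" "b \<in> set w" "conflict a b"
  shows "\<exists>u a b v. commute_eq w (u @ [a, b] @ v) \<and> conflict a b"
proof -
  have "\<exists>a \<in> set w. \<exists>b \<in> set w. conflict a b"
    using assms by blast
  from split_list_last_prop[OF this] obtain u a zs
    where w: "w = u @ a # zs" and a: "\<exists>b \<in> set w. conflict a b"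
      and last: "\<forall>c \<in> set zs. \<not> (\<exists>b \<in> set w. conflict c b)"
    by blast
  have ord: "sorted_wrt precedes (u @ a # zs)" and val: "\<forall>x \<in> set (u @ a # zs). valid n x"
    using assms(1,2) w by auto
  obtain i j where aX: "a = X i j"
    using a by (cases a) auto
  obtain b where "conflict a b" "b \<in> set w"
    using a by blast
  moreover have "b \<noteq> a"
    using \<open>conflict a b\<close> val aX by auto
  moreover have "b \<notin> set u"
    using conflict_not_precedes[OF \<open>conflict a b\<close>] ord val by (auto simp: sorted_wrt_append)
  ultimately have "\<exists>b \<in> set zs. conflict a b"
    using w by auto
  from split_list_first_prop[OF this] obtain w' b v
    where zs: "zs = w' @ b # v" and b: "conflict a b" and first: "\<forall>c \<in> set w'. \<not> conflict a c"
    by blast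
  define D where "D c \<longleftrightarrow> \<not> vertex_disjoint a c" for c
  have prec: "precedes a b" "\<And>c. c \<in> set w' \<Longrightarrow> precedes a c" "\<And>c. c \<in> set w' \<Longrightarrow> precedes c b"
    and ord': "sorted_wrt precedes w'"
    using ord zs by (auto simp: sorted_wrt_append)
  have vals: "valid n a" "valid n b" "\<And>c. c \<in> set w' \<Longrightarrow> valid n c"
    using val zs by auto
  have noconf: "\<And>c d. c \<in> set w' \<Longrightarrow> d \<in> set w' \<Longrightarrow> \<not> conflict c d"
    "\<And>c. c \<in> set w' \<Longrightarrow> \<not> conflict c b"
    using last w zs by auto
  \<comment> \<open>A letter after \<open>a\<close> that meets it without conflict is a negative
    edge sharing the smaller or the larger endpoint. An edge \<open>X k j\<close> would conflict
    with \<open>b\<close> just as \<open>a\<close> does, although \<open>a\<close> is the last such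
    letter.\<close>
  have D: "\<exists>l < j. c = X i l" if "c \<in> set w'" "D c" for c
    using prec(2)[OF that(1)] vals(1) vals(3)[OF that(1)] first that b noconf(2)[OF that(1)] aX
    unfolding D_def by (cases c) (auto simp: precedes_simps)
  have "vertex_disjoint c b" if "c \<in> set w'" "D c" for c
  proof -
    from D[OF that] obtain l where "l < j" "c = X i l"
      by blast
    then show ?thesis
      using prec(1) vals(1,2) vals(3)[OF that(1)] noconf(2)[OF that(1)] b aX
      by (cases b) (auto simp: precedes_simps)
  qed
  \<comment> \<open>\<open>d\<close> avoids \<open>i\<close> and \<open>j\<close>, so it could meet
    \<open>c = X i l\<close> only at \<open>l\<close>. There it would conflict with
    \<open>c\<close>, or be some \<open>X k l\<close> with \<open>k < i\<close>, which crosses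
    \<open>a\<close>.\<close>
  moreover have "vertex_disjoint c d"
    if "c \<in> set w'" "d \<in> set w'" "precedes c d" "D c" "\<not> D d" for c d
  proof -
    from D[OF that(1,4)] obtain l where "l < j" "c = X i l"
      by blast
    then show ?thesis
      using prec(2)[OF that(2)] vals(1) vals(3)[OF that(1)] vals(3)[OF that(2)] noconf(1)[OF that(1,2)]
        that(3,5) aX unfolding D_def
      by (cases d) (auto simp: precedes_simps)
  qed
  then have "sorted_wrt (\<lambda>c d. D c \<longrightarrow> \<not> D d \<longrightarrow> vertex_disjoint c d) w'"
    by (intro sorted_wrt_mono_rel[OF _ ord']) blast
  ultimately obtain u' v' where "commute_eq (a # w' @ [b]) (u' @ [a, b] @ v')"
    using commute_eq_adjacent[of D w' a b] D_def by blast
  then have "commute_eq (u @ (a # w' @ [b]) @ v) (u @ (u' @ [a, b] @ v') @ v)"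
    by (rule commute_eq_context)
  then have "commute_eq w ((u @ u') @ [a, b] @ (v' @ v))"
    by (simp add: w zs)
  then show ?thesis
    using b by blast
qed

lemma irreducible_alternating:
  assumes "\<not> (\<exists>Q. reduction_step n P Q)" "m \<in> Poly_Mapping.keys P" "good n m"
  shows "alternating_letters (letters m)"
  unfolding alternating_letters_def
proof (intro ballI notI)
  fix a b assume ab: "a \<in> letters m" "b \<in> letters m" "conflict a b"
  obtain w where m: "m = abs_monomial w"
    by (rule monomial_word)
  obtain u a b v where w: "commute_eq w (u @ [a, b] @ v)" and conf: "conflict a b"
    using adjacent_conflict[of w n a b] ab assms(3) by (auto simp: m good_def monomial_simps)
  have m': "m = abs_monomial (u @ [a, b] @ v)"
    using m abs_monomial_eqI[OF w] by simp
  then have "precedes a b" "valid n a" "valid n b"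
    using assms(3) by (auto simp: good_def monomial_simps sorted_wrt_append)
  then obtain r where r: "bracket_rule n a b r"
    using conflict_bracket_rule[OF conf] by blast
  have "m = abs_monomial u + letter_monomial a + letter_monomial b + abs_monomial v"
    by (simp add: m' monomial_simps)
  then show False
    using reduction_step.intros[OF assms(2) _ r refl] assms(1) by blast
qed

section \<open>Recovering an alternating graph and its weights from the weighted sum\<close>

lemma valid_lo_le_hi: "valid n a \<Longrightarrow> lo a \<le> hi a"
  by (cases a) auto

lemma vec_neg_iff: "valid n a \<Longrightarrow> vec a v < 0 \<longleftrightarrow> (\<exists>i. a = X i v)"
  by (cases a) auto

lemma vec_pos_iff: "valid n a \<Longrightarrow> 0 < vec a v \<longleftrightarrow> v = lo a \<or> positive a \<and> v = hi a"
  by (cases a) auto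

text \<open>Graph and weights are merged into one function whose support is the graph. Lowering a
  weight, possibly to 0, then stays within the same class, which the induction in
  \<open>configuration_unique\<close> relies on.\<close>

definition configuration :: "nat \<Rightarrow> (letter \<Rightarrow> nat) \<Rightarrow> bool" where
  "configuration n f \<longleftrightarrow> finite {a. 0 < f a} \<and> (\<forall>a. 0 < f a \<longrightarrow> valid n a) \<and>
    (\<forall>a b. 0 < f a \<longrightarrow> 0 < f b \<longrightarrow> \<not> conflict a b \<and> (a \<noteq> b \<longrightarrow> compatible a b))"

abbreviation weight_vector :: "(letter \<Rightarrow> nat) \<Rightarrow> nat \<Rightarrow> int" where
  "weight_vector f \<equiv> wsum f {a. 0 < f a}"

lemma wsum_superset:
  assumes "finite S" "{a. 0 < f a} \<subseteq> S"
  shows "weight_vector f v = wsum f S v"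
  unfolding wsum_def using assms by (intro sum.mono_neutral_left) auto

context
  fixes n f
  assumes conf: "configuration n f"
begin

lemma configurationD:
  "finite {a. 0 < f a}" "0 < f a \<Longrightarrow> valid n a" "0 < f a \<Longrightarrow> 0 < f b \<Longrightarrow> \<not> conflict a b"
  "0 < f a \<Longrightarrow> 0 < f b \<Longrightarrow> a \<noteq> b \<Longrightarrow> compatible a b"
  using conf by (auto simp: configuration_def)

text \<open>Alternation excludes cancellation: all letters at \<open>v\<close> contribute with the
  same sign. So the signs of the weight vector display the sources and sinks of the graph.\<close>

lemma weight_vector_pos:
  assumes "0 < f a" "v = lo a \<or> positive a \<and> v = hi a"
  shows "0 < weight_vector f v"
proof -
  have "0 \<le> vec b v" if "0 < f b" for b
    using vec_neg_iff[OF configurationD(2)[OF that], of v] configurationD(3)[OF that assms(1)] assms(2)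
    by (metis conflict.simps(1) linorder_not_le)
  moreover have "0 < vec a v"
    using vec_pos_iff[OF configurationD(2)[OF assms(1)], of v] assms(2) by blast
  ultimately show ?thesis
    unfolding wsum_def using assms(1) configurationD(1)
    by (intro sum_pos2[of _ a]) auto
qed

lemma weight_vector_neg:
  assumes "0 < f (X i v)"
  shows "weight_vector f v < 0"
proof -
  have "vec b v \<le> 0" if "0 < f b" for b
    using vec_pos_iff[OF configurationD(2)[OF that], of v] configurationD(3)[OF assms that] by fastforce
  moreover have "vec (X i v) v < 0"
    using vec_neg_iff[OF configurationD(2)[OF assms], of v] by blast
  ultimately have "0 < (\<Sum>b | 0 < f b. - (int (f b) * vec b v))"
    using assms configurationD(1)
    by (intro sum_pos2[of _ "X i v"]) (auto simp: mult_nonneg_nonpos mult_pos_neg)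
  then show ?thesis
    by (simp add: wsum_def sum_negf)
qed

lemma weight_vector_posD:
  assumes "0 < weight_vector f v"
  obtains a where "0 < f a" "v = lo a \<or> positive a \<and> v = hi a"
proof -
  have "\<exists>a. 0 < f a \<and> 0 < vec a v"
  proof (rule ccontr)
    assume "\<not> (\<exists>a. 0 < f a \<and> 0 < vec a v)"
    then have "int (f a) * vec a v \<le> 0" if "0 < f a" for a
      using that by (intro mult_nonneg_nonpos) (simp, meson not_less)
    then have "weight_vector f v \<le> 0"
      unfolding wsum_def by (intro sum_nonpos) simp
    then show False
      using assms by simp
  qed
  then obtain a where a: "0 < f a" "0 < vec a v"
    by blast
  then show thesis
    using that[OF a(1)] vec_pos_iff[OF configurationD(2)[OF a(1)], of v] by simp
qed

lemma weight_vector_negD: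
  assumes "weight_vector f v < 0"
  obtains i where "0 < f (X i v)"
proof -
  have "\<exists>a. 0 < f a \<and> vec a v < 0"
  proof (rule ccontr)
    assume "\<not> (\<exists>a. 0 < f a \<and> vec a v < 0)"
    then have "0 \<le> int (f a) * vec a v" if "0 < f a" for a
      using that by (intro mult_nonneg_nonneg) (simp, meson not_less)
    then have "0 \<le> weight_vector f v"
      unfolding wsum_def by (intro sum_nonneg) simp
    then show False
      using assms by simp
  qed
  then obtain a where a: "0 < f a" "vec a v < 0"
    by blast
  then obtain i where "a = X i v"
    using vec_neg_iff[OF configurationD(2)[OF a(1)], of v] by auto
  then show thesis
    using that[of i] a(1) by simp
qed

text \<open>The nearest source to the left of the leftmost sink is joined to it: another edge at this
  source would cross the edge entering the sink, or lie below it.\<close>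

lemma leftmost_sink_edge:
  assumes j: "weight_vector f j < 0" "\<And>l. l < j \<Longrightarrow> \<not> weight_vector f l < 0"
    and i: "0 < weight_vector f i" "i < j" "\<And>l. i < l \<Longrightarrow> l < j \<Longrightarrow> \<not> 0 < weight_vector f l"
  shows "0 < f (X i j)"
proof -
  obtain k where k: "0 < f (X k j)"
    using weight_vector_negD[OF j(1)] .
  have "0 < weight_vector f k" "k < j"
    using weight_vector_pos[OF k, of k] configurationD(2)[OF k] by auto
  then have "k \<le> i"
    using i(3) by (meson not_le_imp_less)
  obtain a where a: "0 < f a" "i = lo a \<or> positive a \<and> i = hi a"
    using weight_vector_posD[OF i(1)] .
  show ?thesis
  proof (cases "k = i")
    case False
    with \<open>k \<le> i\<close> have "k < i"
      by simp
    have ne: "a \<noteq> X k j"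
      using a(2) \<open>k < i\<close> by auto
    have comp: "compatible a (X k j)" and val: "valid n a" and confl: "\<not> conflict (X k j) a"
      using configurationD(4)[OF a(1) k ne] configurationD(2)[OF a(1)] configurationD(3)[OF k a(1)] by auto
    show ?thesis
    proof (cases a)
      case (X p l)
      \<comment> \<open>Otherwise \<open>l\<close> would be a sink to the left of the leftmost
        one.\<close>
      then have "\<not> l < j"
        using j(2) weight_vector_neg a(1) by blast
      then show ?thesis
        using X a comp val \<open>k < i\<close> \<open>i < j\<close> by (auto simp: compatible_def crossing_def)
    next
      case (Y p q)
      then show ?thesis
        using a comp val confl \<open>k < i\<close> \<open>i < j\<close> by (auto simp: compatible_def crossing_def)
    next
      case (Z p)
      then show ?thesis
        using a comp val \<open>k < i\<close> \<open>i < j\<close> by (auto simp: compatible_def crossing_def)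
    qed
  qed (use k in simp)
qed

text \<open>Without sinks every edge is positive and both its endpoints are sources, so a single
  source leaves only the loop.\<close>

lemma single_source_edge:
  assumes "\<And>v. \<not> weight_vector f v < 0" "0 < weight_vector f m" "\<And>v. 0 < weight_vector f v \<Longrightarrow> v = m"
  shows "0 < f (Z m)"
proof -
  obtain a where a: "0 < f a"
    using weight_vector_posD[OF assms(2)] .
  have "lo a = m" "positive a \<Longrightarrow> hi a = m"
    using weight_vector_pos[OF a] assms(3) by simp_all
  then show ?thesis
    using weight_vector_neg assms(1) configurationD(2)[OF a] a by (cases a) auto
qed

text \<open>All edges are positive. Take one edge at \<open>m\<close> and one at \<open>M\<close>.
  Two nonloops must overlap by admissibility, and without a crossing one of them spans from
  \<open>m\<close> to \<open>M\<close>; a loop must lie within the span of the other edge, which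
  again makes that edge \<open>Y m M\<close>.\<close>

lemma outermost_edge:
  assumes nonneg: "\<And>v. \<not> weight_vector f v < 0"
    and m: "0 < weight_vector f m" and M: "0 < weight_vector f M" "m < M"
    and between: "\<And>v. 0 < weight_vector f v \<Longrightarrow> m \<le> v \<and> v \<le> M"
  shows "0 < f (Y m M)"
proof -
  have pos: "positive a" if "0 < f a" for a
    using that weight_vector_neg nonneg by (cases a) auto
  have range: "m \<le> lo a \<and> hi a \<le> M" if "0 < f a" for a
    using weight_vector_pos[OF that] between pos[OF that] by blast
  have le: "lo a \<le> hi a" if "0 < f a" for a
    using configurationD(2)[OF that] by (rule valid_lo_le_hi)
  obtain a where a: "0 < f a" "m = lo a \<or> positive a \<and> m = hi a"
    using weight_vector_posD[OF m] .
  then have a': "m = lo a"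
    using range[of a] le[of a] by linarith
  obtain b where b: "0 < f b" "M = lo b \<or> positive b \<and> M = hi b"
    using weight_vector_posD[OF M(1)] .
  then have b': "M = hi b"
    using range[of b] le[of b] by linarith
  have "compatible a b \<or> a = b"
    using configurationD(4) a b by blast
  then show ?thesis
    using a(1) b(1) a' b' range[OF a(1)] range[OF b(1)] pos[OF a(1)] pos[OF b(1)] M(2)
      configurationD(2)[OF a(1)] configurationD(2)[OF b(1)]
    by (cases a; cases b) (auto simp: compatible_def crossing_def)
qed

end

text \<open>The edge found by each of the three preceding lemmas is located by the signs of the
  weight vector alone, so it occurs in both configurations.\<close>

lemma configuration_common_letter:
  assumes f: "configuration n f" and g: "configuration n g"
    and eq: "\<And>v. weight_vector f v = weight_vector g v" and a: "0 < f a"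
  shows "\<exists>a. 0 < f a \<and> 0 < g a"
proof -
  let ?p = "weight_vector f"
  have eq': "?p = weight_vector g"
    using eq by (rule ext)
  show ?thesis
  proof (cases "\<exists>j. ?p j < 0")
    case True
    define j where "j = (LEAST j. ?p j < 0)"
    have j: "?p j < 0" "\<And>l. l < j \<Longrightarrow> \<not> ?p l < 0"
      using LeastI_ex[OF True] not_less_Least unfolding j_def by blast+
    obtain k where k: "0 < f (X k j)"
      using weight_vector_negD[OF f j(1)] .
    then have "0 < ?p k" "k < j"
      using weight_vector_pos[OF f k, of k] configurationD(2)[OF f k] by auto
    define i where "i = Max {i. 0 < ?p i \<and> i < j}"
    have "finite {i. 0 < ?p i \<and> i < j}" "{i. 0 < ?p i \<and> i < j} \<noteq> {}"
      using \<open>0 < ?p k\<close> \<open>k < j\<close> by auto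
    then have "i \<in> {i. 0 < ?p i \<and> i < j}" and max: "\<And>l. 0 < ?p l \<Longrightarrow> l < j \<Longrightarrow> l \<le> i"
      unfolding i_def using Max_in Max_ge by (blast, auto)
    then have i: "0 < ?p i" "i < j" "\<And>l. i < l \<Longrightarrow> l < j \<Longrightarrow> \<not> 0 < ?p l"
      using not_le by auto
    show ?thesis
      using leftmost_sink_edge[OF f j i] leftmost_sink_edge[OF g, of j i] j i unfolding eq' by blast
  next
    case False
    then have nonneg: "\<And>v. \<not> ?p v < 0"
      by blast
    let ?S = "{v. 0 < ?p v}"
    have S_le: "v \<le> n" if "0 < ?p v" for v
    proof -
      from weight_vector_posD[OF f that] obtain b where b: "0 < f b" "v = lo b \<or> positive b \<and> v = hi b" .
      then show ?thesis
        using configurationD(2)[OF f b(1)] by (cases b) fastforce+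
    qed
    then have fin: "finite ?S"
      by (auto simp: finite_nat_set_iff_bounded_le)
    have ne: "?S \<noteq> {}"
      using weight_vector_pos[OF f a, of "lo a"] by auto
    let ?m = "Min ?S" and ?M = "Max ?S"
    have m: "0 < ?p ?m" and M: "0 < ?p ?M"
      using Min_in[OF fin ne] Max_in[OF fin ne] by auto
    have between: "?m \<le> v \<and> v \<le> ?M" if "0 < ?p v" for v
      using that fin by auto
    show ?thesis
    proof (cases "?m = ?M")
      case True
      then have "\<And>v. 0 < ?p v \<Longrightarrow> v = ?m"
        using between by (metis le_antisym)
      then show ?thesis
        using single_source_edge[OF f nonneg m] single_source_edge[OF g, of ?m] nonneg m
        unfolding eq' by blast
    next
      case False
      then have "?m < ?M"
        using between[OF m] by simp
      then show ?thesis
        using outermost_edge[OF f nonneg m M _ between] outermost_edge[OF g, of ?m ?M] nonneg m M between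
        unfolding eq' by blast
    qed
  qed
qed

lemma configuration_decrease:
  assumes "configuration n f" "0 < f a"
  shows "configuration n (f(a := f a - 1))"
    and "weight_vector (f(a := f a - 1)) v = weight_vector f v - vec a v"
proof -
  let ?S = "{a. 0 < f a}"
  have sub: "{b. 0 < (f(a := f a - 1)) b} \<subseteq> ?S"
    using assms(2) by auto
  have fin: "finite ?S"
    using assms(1) by (simp add: configuration_def)
  show "configuration n (f(a := f a - 1))"
    unfolding configuration_def
    using finite_subset[OF sub fin] sub assms(1) unfolding configuration_def by blast
  define B where "B = ?S - {a}"
  have S: "?S = insert a B" "a \<notin> B" "finite B"
    using assms(2) fin by (auto simp: B_def)
  have "wsum (f(a := f a - 1)) (insert a B) v = wsum f (insert a B) v - vec a v"
    using S(2,3) assms(2) by (simp add: wsum_insert wsum_fun_upd of_nat_diff algebra_simps)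
  then show "weight_vector (f(a := f a - 1)) v = weight_vector f v - vec a v"
    unfolding S(1)[symmetric] using wsum_superset[OF fin sub, of v] by (rule trans[rotated])
qed

text \<open>Lowering the weight of a common letter by one in both configurations keeps the weight
  vectors equal and decreases the total weight, which is the induction measure.\<close>

lemma configuration_unique:
  assumes "configuration n f" "configuration n g" "\<And>v. weight_vector f v = weight_vector g v"
  shows "f = g"
  using assms
proof (induction "sum f {a. 0 < f a}" arbitrary: f g rule: less_induct)
  case less
  show ?case
  proof (cases "\<exists>a. 0 < f a \<and> 0 < g a")
    case True
    then obtain a where a: "0 < f a" "0 < g a"
      by blast
    let ?f = "f(a := f a - 1)" and ?g = "g(a := g a - 1)"
    have fin: "finite {a. 0 < f a}"
      using less.prems(1) by (simp add: configuration_def)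
    have "sum ?f {b. 0 < ?f b} \<le> sum ?f {a. 0 < f a}"
      using fin a by (intro sum_mono2) (auto split: if_splits)
    also have "\<dots> < sum f {a. 0 < f a}"
      using fin a by (intro sum_strict_mono_ex1) auto
    finally have "?f = ?g"
      using less.hyps[of ?f ?g] configuration_decrease[OF less.prems(1) a(1)]
        configuration_decrease[OF less.prems(2) a(2)] less.prems(3) by simp
    have "f b = g b" for b
      using a fun_cong[OF \<open>?f = ?g\<close>, of b] by (cases "b = a") auto
    then show ?thesis
      by (rule ext)
  next
    case False
    then have "\<not> 0 < f a" "\<not> 0 < g a" for a
      using configuration_common_letter[OF less.prems, of a]
        configuration_common_letter[OF less.prems(2,1) less.prems(3)[symmetric], of a] by blast+
    then show ?thesis
      by (simp add: fun_eq_iff)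
  qed
qed

section \<open>Weightings of the path given by the initial monomial\<close>

definition path :: "nat \<Rightarrow> letter set" where
  "path n = (\<lambda>i. X i (i + 1)) ` {1..<n} \<union> {Z n}"

text \<open>The pairing of \<open>vec a\<close> with \<open>e_1 + ... + e_k\<close>. It is
  nonnegative on every valid letter, and for \<open>k\<close> from 1 to \<open>n\<close> these
  functionals form the basis dual to the vectors of the path.\<close>

definition coverage :: "letter \<Rightarrow> nat \<Rightarrow> int" where
  "coverage a k = (\<Sum>v\<le>k. vec a v)"

lemma coverage_simps [simp]:
  "coverage (X i j) k = of_bool (i \<le> k) - of_bool (j \<le> k)"
  "coverage (Y i j) k = of_bool (i \<le> k) + of_bool (j \<le> k)"
  "coverage (Z i) k = of_bool (i \<le> k)"
proof -
  have "(\<Sum>v\<le>k. of_bool (v = i)) = (of_bool (i \<le> k) :: int)" for i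
    by (simp add: of_bool_def sum.delta)
  then show "coverage (X i j) k = of_bool (i \<le> k) - of_bool (j \<le> k)"
    "coverage (Y i j) k = of_bool (i \<le> k) + of_bool (j \<le> k)"
    "coverage (Z i) k = of_bool (i \<le> k)"
    unfolding coverage_def by (simp_all add: sum_subtractf sum.distrib)
qed

lemma sum_wsum: "(\<Sum>v\<le>k. wsum f A v) = (\<Sum>a\<in>A. int (f a) * coverage a k)"
  unfolding wsum_def coverage_def by (subst sum.swap) (simp add: sum_distrib_left)

lemma coverage_nonneg: "valid n a \<Longrightarrow> 0 \<le> coverage a k"
  by (cases a) auto

lemma finite_path: "finite (path n)"
  by (simp add: path_def)

lemma coverage_path:
  assumes "b \<in> path n" "1 \<le> k" "k \<le> n"
  shows "coverage b k = of_bool (lo b = k)"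
  using assms by (auto simp: path_def)

lemma lo_path:
  assumes "1 \<le> k" "k \<le> n"
  obtains a where "a \<in> path n" "lo a = k" "\<And>b. b \<in> path n \<Longrightarrow> lo b = k \<longleftrightarrow> b = a"
proof (cases "k = n")
  case True
  then have "Z n \<in> path n" "lo (Z n) = k" "\<And>b. b \<in> path n \<Longrightarrow> lo b = k \<longleftrightarrow> b = Z n"
    by (auto simp: path_def)
  then show ?thesis
    by (rule that)
next
  case False
  then have "X k (k + 1) \<in> path n" "lo (X k (k + 1)) = k"
    "\<And>b. b \<in> path n \<Longrightarrow> lo b = k \<longleftrightarrow> b = X k (k + 1)"
    using assms by (auto simp: path_def)
  then show ?thesis
    by (rule that)
qed

lemma sum_coverage_path:
  assumes "a \<in> path n" "1 \<le> n"
  shows "(\<Sum>b\<in>path n. int (f b) * coverage b (lo a)) = int (f a)"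
proof -
  have k: "1 \<le> lo a" "lo a \<le> n"
    using assms by (auto simp: path_def)
  obtain a' where a': "a' \<in> path n" "\<And>b. b \<in> path n \<Longrightarrow> lo b = lo a \<longleftrightarrow> b = a'"
    using lo_path[OF k] by metis
  then have "a' = a"
    using assms(1) by auto
  have "(\<Sum>b\<in>path n. int (f b) * coverage b (lo a)) = (\<Sum>b\<in>path n. if b = a then int (f b) else 0)"
    using a'(2) k unfolding \<open>a' = a\<close> by (intro sum.cong refl) (simp add: coverage_path)
  then show ?thesis
    using assms(1) finite_path by simp
qed

text \<open>By duality the weight of a path letter is a partial sum of \<open>p\<close>. Hence there
  is at most one weighting of the path, and positivity of the partial sums governs its
  existence.\<close>

lemma weightings_pathD:
  assumes "f \<in> weightings p (path n)" "1 \<le> n" "a \<in> path n"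
  shows "int (f a) = (\<Sum>v\<le>lo a. p v)"
  using sum_coverage_path[OF assms(3,2), of f] weightings_wsum[OF assms(1)]
  by (simp add: sum_wsum[symmetric])

lemma weightings_path_unique:
  assumes "f \<in> weightings p (path n)" "g \<in> weightings p (path n)" "1 \<le> n"
  shows "f = g"
proof
  fix a
  show "f a = g a"
    using weightings_pathD[OF assms(1,3), of a] weightings_pathD[OF assms(2,3), of a]
      weightings_zero[OF assms(1), of a] weightings_zero[OF assms(2), of a]
    by (cases "a \<in> path n") auto
qed

lemma weightings_path_partial_sums:
  assumes "f \<in> weightings p (path n)" "1 \<le> k" "k \<le> n"
  shows "0 < (\<Sum>v\<le>k. p v)"
proof -
  obtain a where a: "a \<in> path n" "lo a = k"
    using lo_path[OF assms(2,3)] by metis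
  then have "0 < f a"
    using weightings_pos[OF assms(1)] by simp
  then show ?thesis
    using weightings_pathD[OF assms(1) _ a(1)] assms(2,3) a(2) by simp
qed

lemma weightings_path_exists:
  assumes "1 \<le> n" "\<And>v. v < 1 \<or> n < v \<Longrightarrow> p v = 0" "\<And>k. 1 \<le> k \<Longrightarrow> k \<le> n \<Longrightarrow> 0 < (\<Sum>v\<le>k. p v)"
  shows "weightings p (path n) \<noteq> {}"
proof -
  define f where "f a = (if a \<in> path n then nat (\<Sum>v\<le>lo a. p v) else 0)" for a
  have lo: "1 \<le> lo a \<and> lo a \<le> n" if "a \<in> path n" for a
    using that assms(1) by (auto simp: path_def)
  have f: "int (f a) = (\<Sum>v\<le>lo a. p v)" "0 < f a" if "a \<in> path n" for a
    using assms(3)[of "lo a"] lo[OF that] that by (auto simp: f_def)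
  \<comment> \<open>Agreement at the single vertices follows below by taking differences of these
    partial sums. Vertex 0 lies outside the graph and is treated separately.\<close>
  have sums: "(\<Sum>v\<le>k. wsum f (path n) v) = (\<Sum>v\<le>k. p v)" if "k \<le> n" for k
  proof (cases "1 \<le> k")
    case True
    from lo_path[OF this that] obtain a where "a \<in> path n" "lo a = k" .
    then show ?thesis
      using sum_coverage_path[of a n f] f[of a] assms(1) by (simp add: sum_wsum)
  next
    case False
    have "vec a 0 = 0" if "a \<in> path n" for a
      using that assms(1) by (auto simp: path_def)
    then show ?thesis
      using False assms(2)[of 0] by (simp add: wsum_def not_le)
  qed
  have "wsum f (path n) v = p v" for v
  proof (cases "v \<le> n")
    case True
    then show ?thesis
    proof (cases v)
      case 0
      then show ?thesis
        using sums[of 0] by simp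
    next
      case (Suc u)
      then show ?thesis
        using sums[of v] sums[of u] True by simp
    qed
  next
    case False
    then have "vec a v = 0" if "a \<in> path n" for a
      using that by (auto simp: path_def)
    then show ?thesis
      using False assms(2)[of v] by (simp add: wsum_def)
  qed
  then have "f \<in> weightings p (path n)"
    using f(2) by (auto simp: weightings_def f_def)
  then show ?thesis
    by blast
qed

definition path_word :: "nat \<Rightarrow> letter list" where
  "path_word n = map (\<lambda>i. X i (i + 1)) [1..<n] @ [Z n]"

lemma w_C_word_poly: "w_C n = word_poly 0 (path_word n)"
proof -
  have "prod_list (map (\<lambda>i. xvar i (i + 1)) js) = word_poly 0 (map (\<lambda>i. X i (i + 1)) js)" for js
  proof (induction js)
    case Nil
    show ?case
      by (simp add: word_poly_def zero_monomial_def[symmetric])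
  next
    case (Cons i js)
    then show ?case
      by (simp add: var_word_poly word_poly_mult)
  qed
  then show ?thesis
    by (simp add: w_C_def path_word_def var_word_poly word_poly_mult)
qed

lemma set_path_word: "set (path_word n) = path n"
  by (auto simp: path_word_def path_def)

lemma forest_path: "forest (path n)"
proof (rule forestI)
  fix t :: "letter \<Rightarrow> bool"
  \<comment> \<open>Each path edge fixes the value at its larger endpoint from the value at its
    smaller one; the initial \<open>False\<close> is arbitrary.\<close>
  define f where "f = rec_nat False (\<lambda>i b. b \<noteq> t (X i (Suc i)))"
  have "f (Suc i) \<longleftrightarrow> f i \<noteq> t (X i (Suc i))" for i
    by (simp add: f_def)
  then show "\<exists>f. \<forall>a\<in>path n. is_loop a \<or> edge_parity f a = t a"
    by (intro exI[of _ f]) (auto simp: path_def)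
qed

lemma good_path_word:
  assumes "1 \<le> n"
  shows "good n (abs_monomial (path_word n))"
proof -
  have "sorted_wrt precedes (map (\<lambda>i. X i (i + 1)) [1..<n])"
    unfolding sorted_wrt_map
    by (rule sorted_wrt_mono_rel[OF _ sorted_wrt_upt]) (auto simp: precedes_simps)
  then have "sorted_wrt precedes (path_word n)"
    by (auto simp: path_word_def sorted_wrt_append precedes_simps)
  moreover have "\<forall>a \<in> path n. valid n a"
    using assms by (auto simp: path_def)
  moreover have "finite (weightings p (path n))" for p
  proof (cases "weightings p (path n) = {}")
    case False
    then obtain f where "f \<in> weightings p (path n)"
      by blast
    then have "weightings p (path n) \<subseteq> {f}"
      using weightings_path_unique[OF _ _ assms] by blast
    then show ?thesis
      by (rule finite_subset) simp
  qed simp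
  ultimately show ?thesis
    by (simp add: good_def monomial_simps set_path_word forest_path)
qed

section \<open>Alternating weakly-well-structured graphs\<close>

fun letter_edge :: "letter \<Rightarrow> edge" where
  "letter_edge (X i j) = (i, j, Neg)"
| "letter_edge (Y i j) = (i, j, Pos)"
| "letter_edge (Z i) = (i, i, Pos)"

lemma edge_letter_letter_edge: "valid n a \<Longrightarrow> edge_letter (letter_edge a) = a"
  by (cases a) auto

definition signed_edge :: "nat \<Rightarrow> edge \<Rightarrow> bool" where
  "signed_edge n e \<longleftrightarrow> (case e of (i, j, s) \<Rightarrow> 1 \<le> i \<and> i \<le> j \<and> j \<le> n \<and> (i = j \<longrightarrow> s = Pos))"

lemma signed_graph_iff: "signed_graph n G \<longleftrightarrow> (\<forall>e \<in> set G. signed_edge n e)"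
  by (simp add: signed_graph_def signed_edge_def)

lemma edge_letter_valid:
  assumes "signed_edge n e"
  shows "valid n (edge_letter e)" "letter_edge (edge_letter e) = e"
proof -
  obtain i j s where e: "e = (i, j, s)"
    by (cases e)
  show "valid n (edge_letter e)" "letter_edge (edge_letter e) = e"
    using assms by (cases s; auto simp: e signed_edge_def)+
qed

lemma signed_edge_letter_edge: "valid n a \<Longrightarrow> signed_edge n (letter_edge a)"
  by (cases a) (auto simp: signed_edge_def)

lemma incident_letter_edge:
  assumes "valid n a"
  shows "incident (letter_edge a) v Pos \<longleftrightarrow> v = lo a \<or> positive a \<and> v = hi a"
    and "incident (letter_edge a) v Neg \<longleftrightarrow> (\<exists>i. a = X i v)"
  using assms by (cases a; auto elim: incident.cases intro: incident.intros)+

lemma alternating_iff: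
  assumes "\<forall>a \<in> set w. valid n a"
  shows "alternating (map letter_edge w) \<longleftrightarrow> alternating_letters (set w)"
proof -
  have conflict: "conflict a b \<longleftrightarrow> (\<exists>v. incident (letter_edge a) v Neg \<and> incident (letter_edge b) v Pos)"
    if "a \<in> set w" "b \<in> set w" for a b
  proof -
    have val: "valid n a" "valid n b"
      using assms that by auto
    have "conflict a b \<longleftrightarrow> (\<exists>v. (\<exists>i. a = X i v) \<and> (v = lo b \<or> positive b \<and> v = hi b))"
      by (cases a) auto
    then show ?thesis
      unfolding incident_letter_edge(2)[OF val(1)] incident_letter_edge(1)[OF val(2)] .
  qed
  show ?thesis
  proof
    assume alt: "alternating (map letter_edge w)"
    show "alternating_letters (set w)"
      unfolding alternating_letters_def
    proof (intro ballI notI)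
      fix a b assume ab: "a \<in> set w" "b \<in> set w" "conflict a b"
      then obtain v where "incident (letter_edge a) v Neg" "incident (letter_edge b) v Pos"
        using conflict[OF ab(1,2)] by blast
      then have "Neg = Pos"
        using alt ab unfolding alternating_def set_map by blast
      then show False
        by simp
    qed
  next
    assume alt: "alternating_letters (set w)"
    have "s = t" if "a \<in> set w" "b \<in> set w" "incident (letter_edge a) v s" "incident (letter_edge b) v t"
      for a b v s t
      using that conflict[OF that(1,2)] conflict[OF that(2,1)] alt unfolding alternating_letters_def
      by (cases s; cases t) auto
    then show "alternating (map letter_edge w)"
      by (auto simp: alternating_def)
  qed
qed

text \<open>Expresses the order of edges through the standard order on triples: positive letters
  come first because \<open>False < True\<close>, and the negated endpoints reverse their
  order.\<close>

definition lex_key :: "letter \<Rightarrow> bool \<times> int \<times> int" where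
  "lex_key a = (\<not> positive a, - int (hi a), - int (lo a))"

lemma lex_less_letter_edge:
  assumes "valid n a" "valid n b"
  shows "lex_less (letter_edge a) (letter_edge b) \<longleftrightarrow> lex_key a < lex_key b"
  using assms by (cases a; cases b) (auto simp: lex_key_def less_prod_def)

lemma lex_key_inj: "valid n a \<Longrightarrow> valid n b \<Longrightarrow> lex_key a = lex_key b \<Longrightarrow> a = b"
  by (cases a; cases b) (auto simp: lex_key_def)

text \<open>On an alternating set, lexicographic sorting therefore produces words sorted by
  \<open>precedes\<close>, which links edge labels to words.\<close>

lemma lex_key_before:
  assumes "valid n a" "valid n b" "lex_key a < lex_key b" "\<not> conflict a b" "\<not> conflict b a"
  shows "vertex_disjoint a b \<or> before a b"
  using assms by (cases a; cases b) (auto simp: lex_key_def less_prod_def vertex_disjoint_def)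

text \<open>Letters standing before \<open>a\<close> in \<open>v\<close> stand after it in
  \<open>u\<close>, so they precede \<open>a\<close> and are preceded by it. That makes them
  disjoint from \<open>a\<close>, and \<open>a\<close> can be moved to the front of
  \<open>v\<close>.\<close>

lemma sorted_wrt_precedes_unique:
  "\<lbrakk>sorted_wrt precedes u; sorted_wrt precedes v; set u = set v; \<forall>a \<in> set u. valid n a\<rbrakk> \<Longrightarrow> commute_eq u v"
proof (induction u arbitrary: v)
  case Nil
  then show ?case
    by (simp add: commute_eq_refl)
next
  case (Cons a u)
  then obtain v1 v2 where v: "v = v1 @ a # v2"
    by (metis list.set_intros(1) split_list)
  have "distinct (a # u)" "distinct v"
    using sorted_wrt_precedes_distinct[OF Cons.prems(1,4)]
      sorted_wrt_precedes_distinct[OF Cons.prems(2), of n] Cons.prems(3,4) by auto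
  then have set: "set (v1 @ v2) = set u"
    using Cons.prems(3) v by auto
  have "vertex_disjoint a x" if "x \<in> set v1" for x
    using that set Cons.prems v precedes_antisym[of a x n]
    by (auto simp: sorted_wrt_append)
  then have "commute_eq (a # v1 @ v2) v"
    using commute_eq_move[of v1 a v2] v by simp
  moreover have "commute_eq u (v1 @ v2)"
    using Cons.IH[of "v1 @ v2"] Cons.prems set v by (auto simp: sorted_wrt_append)
  ultimately show ?case
    using commute_eq_trans commute_eq_Cons by blast
qed

lemma sorted_precedes_compatible:
  assumes "sorted_wrt precedes w" "a \<in> set w" "b \<in> set w" "a \<noteq> b"
  shows "compatible a b"
proof -
  obtain i j where "i < length w" "w ! i = a" "j < length w" "w ! j = b"
    using assms(2,3) by (metis in_set_conv_nth)
  moreover from this have "i < j \<or> j < i"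
    using assms(4) by (metis linorder_neqE_nat)
  ultimately have "precedes a b \<or> precedes b a"
    using assms(1) unfolding sorted_wrt_iff_nth_less by blast
  then show ?thesis
    using compatible_sym by (auto simp: precedes_def)
qed

lemma sorted_lex_key_precedes:
  assumes "sorted_wrt (\<lambda>a b. lex_key a < lex_key b) w" "\<forall>a \<in> set w. valid n a"
    "\<And>a b. a \<in> set w \<Longrightarrow> b \<in> set w \<Longrightarrow> a \<noteq> b \<Longrightarrow> compatible a b" "alternating_letters (set w)"
  shows "sorted_wrt precedes w"
proof (rule sorted_wrt_mono_rel[OF _ assms(1)])
  fix a b assume "a \<in> set w" "b \<in> set w" "lex_key a < lex_key b"
  then show "precedes a b"
    using lex_key_before[of n a b] assms(2-4) unfolding precedes_def alternating_letters_def by blast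
qed

lemma lexicographic_labels_iff:
  assumes "\<forall>a \<in> set w. valid n a" "distinct w"
  shows "lexicographic_labels (map letter_edge w) \<longleftrightarrow> sorted_wrt (\<lambda>a b. lex_key a < lex_key b) w"
proof -
  have "lex_less (letter_edge (w ! i)) (letter_edge (w ! j)) \<longleftrightarrow> lex_key (w ! i) < lex_key (w ! j)"
    if "i < length w" "j < length w" for i j
    using that assms(1) lex_less_letter_edge nth_mem by blast
  then have eq: "lexicographic_labels (map letter_edge w) \<longleftrightarrow>
      (\<forall>i < length w. \<forall>j < length w. lex_key (w ! i) < lex_key (w ! j) \<longrightarrow> i < j)"
    by (simp add: lexicographic_labels_def)
  have neq: "lex_key (w ! i) \<noteq> lex_key (w ! j)" if "i < j" "j < length w" for i j
    using that lex_key_inj[of n "w ! i" "w ! j"] assms nth_eq_iff_index_eq[of w i j] by auto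
  show ?thesis
    unfolding eq sorted_wrt_iff_nth_less
  proof (intro iffI allI impI)
    fix i j assume *: "\<forall>i<length w. \<forall>j<length w. lex_key (w ! i) < lex_key (w ! j) \<longrightarrow> i < j"
      "i < j" "j < length w"
    then have "\<not> lex_key (w ! j) < lex_key (w ! i)"
      by (meson less_asym less_trans)
    then show "lex_key (w ! i) < lex_key (w ! j)"
      using neq[OF *(2,3)] by (simp add: not_less order.strict_iff_order)
  next
    fix i j assume *: "\<forall>i j. i < j \<longrightarrow> j < length w \<longrightarrow> lex_key (w ! i) < lex_key (w ! j)"
      "i < length w" "j < length w" "lex_key (w ! i) < lex_key (w ! j)"
    show "i < j"
    proof (rule ccontr)
      assume "\<not> i < j"
      then have "j < i"
        using *(4) by (cases "i = j") auto
      then have "lex_key (w ! j) < lex_key (w ! i)"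
        using *(1,2) by blast
      then show False
        using *(4) by (rule less_asym)
    qed
  qed
qed

text \<open>Choose a functional that is true on exactly one edge of the cycle. Its vertex values
  would then change exactly once around the cycle, which is impossible.\<close>

lemma forest_no_cycle:
  assumes "forest (set w)" "distinct w"
  shows "\<not> has_nonloop_cycle (map letter_edge w)"
proof
  assume "has_nonloop_cycle (map letter_edge w)"
  then obtain vs as where vs: "length vs \<ge> 2" "length as = length vs" "distinct vs"
    and as: "distinct as" "set as \<subseteq> {..<length w}"
    and joins: "\<And>t. t < length vs \<Longrightarrow>
      joins (map letter_edge w ! (as ! t)) (vs ! t) (vs ! (Suc t mod length vs))"
    unfolding has_nonloop_cycle_def by auto
  let ?r = "length vs"
  have lt: "as ! t < length w" if "t < ?r" for t
    using as(2) vs(2) that by (metis lessThan_iff nth_mem subsetD)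
  obtain f where f: "\<forall>a \<in> set w. is_loop a \<or> edge_parity f a = (a = w ! (as ! 0))"
    using forestD[OF assms(1), of "\<lambda>a. a = w ! (as ! 0)"] by (elim exE)
  have step: "f (vs ! t) \<noteq> f (vs ! (Suc t mod ?r)) \<longleftrightarrow> t = 0" if t: "t < ?r" for t
  proof -
    let ?a = "w ! (as ! t)"
    have "Suc t mod ?r \<noteq> t"
      using t vs(1) by (cases "Suc t = ?r") auto
    moreover have "Suc t mod ?r < ?r"
      using t by (intro mod_less_divisor) linarith
    ultimately have "vs ! t \<noteq> vs ! (Suc t mod ?r)"
      using vs(3) t by (metis nth_eq_iff_index_eq)
    moreover have "joins (letter_edge ?a) (vs ! t) (vs ! (Suc t mod ?r))"
      using joins[OF t] lt[OF t] by simp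
    ultimately have "\<not> is_loop ?a" "edge_parity f ?a \<longleftrightarrow> f (vs ! t) \<noteq> f (vs ! (Suc t mod ?r))"
      by (cases ?a; auto)+
    moreover have "?a = w ! (as ! 0) \<longleftrightarrow> t = 0"
    proof -
      have "0 < ?r"
        using vs(1) by linarith
      then show ?thesis
        using assms(2) lt[OF t] lt[of 0] as(1) t vs(2)
        by (simp add: nth_eq_iff_index_eq)
    qed
    ultimately show ?thesis
      using f lt[OF t] nth_mem by blast
  qed
  \<comment> \<open>The only change happens between vertices 0 and 1, so the values are constant
    from vertex 1 onwards and, through the closing edge, equal to the value at vertex 0.\<close>
  have const: "f (vs ! Suc t) = f (vs ! 1)" if "Suc t < ?r" for t
    using that
  proof (induction t)
    case (Suc t)
    then show ?case
      using step[of "Suc t"] by simp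
  qed simp
  have "f (vs ! (?r - 1)) = f (vs ! 1)"
  proof -
    have "Suc (?r - 2) = ?r - 1"
      using vs(1) by linarith
    then show ?thesis
      using const[of "?r - 2"] vs(1) by simp
  qed
  moreover have "f (vs ! (?r - 1)) = f (vs ! 0)"
  proof -
    obtain q where "?r = Suc q"
      using vs(1) by (cases ?r) auto
    then show ?thesis
      using step[of q] vs(1) by auto
  qed
  moreover have "f (vs ! 0) \<noteq> f (vs ! 1)"
  proof -
    have "0 < ?r" "Suc 0 mod ?r = 1"
      using vs(1) by (linarith, simp)
    then show ?thesis
      using step[of 0] by simp
  qed
  ultimately show False
    by simp
qed

lemma parallel_edges_cycle:
  assumes "a < b" "b < length G" "G ! a = G ! b" "G ! a = (i, j, s)" "i \<noteq> j"
  shows "has_nonloop_cycle G"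
proof -
  have "G ! b = (i, j, s)"
    using assms(3,4) by simp
  then have "joins (G ! ([a, b] ! t)) ([i, j] ! t) ([i, j] ! (Suc t mod length [i, j]))" if "t < 2" for t
    using that assms(4) by (cases t) (auto simp: less_Suc_eq numeral_2_eq_2)
  then show ?thesis
    unfolding has_nonloop_cycle_def using assms(1,2,5)
    by (intro exI[of _ "[i, j]"] exI[of _ "[a, b]"]) (auto simp: numeral_2_eq_2)
qed

lemma coverage_pos_iff: "valid n a \<Longrightarrow> 0 < coverage a k \<longleftrightarrow> lo a \<le> k \<and> (positive a \<or> k < hi a)"
  by (cases a) auto

text \<open>If every edge at 1 is negative, let \<open>X 1 J\<close> be the longest one. A letter
  with positive coverage at \<open>J\<close> starts after 1 and no later than \<open>J\<close>, so
  it crosses this edge, lies below it, or conflicts with it at \<open>J\<close>.\<close>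

lemma positive_at_1:
  assumes valid: "\<And>a. a \<in> A \<Longrightarrow> valid n a" and n: "1 \<le> n"
    and comp: "\<And>a b. a \<in> A \<Longrightarrow> b \<in> A \<Longrightarrow> a \<noteq> b \<Longrightarrow> compatible a b"
    and alt: "alternating_letters A"
    and cover: "\<And>k. 1 \<le> k \<Longrightarrow> k \<le> n \<Longrightarrow> \<exists>a\<in>A. 0 < coverage a k"
  shows "\<exists>a\<in>A. positive a \<and> lo a = 1"
proof (rule ccontr)
  assume none: "\<not> ?thesis"
  obtain a where a: "a \<in> A" "0 < coverage a 1"
    using cover[of 1] n by auto
  then have "\<exists>h. a = X 1 h"
    using none valid[OF a(1)] by (cases a) (auto simp: coverage_pos_iff)
  then have ne: "{h. X 1 h \<in> A} \<noteq> {}"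
    using a(1) by auto
  have "{h. X 1 h \<in> A} \<subseteq> {..n}"
    using valid by fastforce
  then have fin: "finite {h. X 1 h \<in> A}"
    by (rule finite_subset) simp
  define J where "J = Max {h. X 1 h \<in> A}"
  have J: "X 1 J \<in> A" and max: "\<And>h. X 1 h \<in> A \<Longrightarrow> h \<le> J"
    using Max_in[OF fin ne] fin by (auto simp: J_def)
  have "1 < J" "J \<le> n"
    using valid[OF J] by auto
  then obtain c where c: "c \<in> A" "0 < coverage c J"
    using cover[of J] by auto
  have "lo c \<noteq> 1"
  proof
    assume "lo c = 1"
    then show False
      using none c valid[OF c(1)] max[of "hi c"] by (cases c) (auto simp: coverage_pos_iff)
  qed
  then have "c \<noteq> X 1 J"
    by auto
  then have "compatible c (X 1 J)" "\<not> conflict (X 1 J) c"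
    using comp[OF c(1) J] alt c(1) J unfolding alternating_letters_def by blast+
  then show False
    using c valid[OF c(1)] \<open>lo c \<noteq> 1\<close> \<open>1 < J\<close>
    by (cases c) (auto simp: coverage_pos_iff compatible_def crossing_def)
qed

lemma lo_hi_letter_edge:
  "letter_edge a = (i, j, s) \<Longrightarrow> lo a = i \<and> hi a = j \<and> (positive a \<longleftrightarrow> s = Pos)"
  by (cases a) auto

lemma letter_edge_Neg: "letter_edge a = (i, j, Neg) \<Longrightarrow> a = X i j"
  by (cases a) auto

lemma letter_edge_Pos: "letter_edge a = (i, j, Pos) \<Longrightarrow> i \<noteq> j \<Longrightarrow> a = Y i j"
  by (cases a) auto

lemma letter_edge_loop: "valid n a \<Longrightarrow> letter_edge a = (i, i, s) \<Longrightarrow> a = Z i"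
  by (cases a) auto

definition loop_edge :: "edge \<Rightarrow> bool" where
  "loop_edge = (\<lambda>(i, j, s). i = j)"

lemma loop_edge_letter_edge: "valid n a \<Longrightarrow> loop_edge (letter_edge a) \<longleftrightarrow> is_loop a"
  by (cases a) (auto simp: loop_edge_def)

lemma length_filter_le_1_iff:
  "length (filter Q xs) \<le> 1 \<longleftrightarrow> (\<forall>i j. i < j \<longrightarrow> j < length xs \<longrightarrow> \<not> (Q (xs ! i) \<and> Q (xs ! j)))"
proof -
  have "length (filter Q xs) = card {i. i < length xs \<and> Q (xs ! i)}"
    by (rule length_filter_conv_card)
  then have "length (filter Q xs) \<le> 1 \<longleftrightarrow>
      (\<forall>i j. i < length xs \<and> Q (xs ! i) \<longrightarrow> j < length xs \<and> Q (xs ! j) \<longrightarrow> i = j)"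
    by (simp add: card_le_Suc0_iff_eq)
  moreover have "\<dots> \<longleftrightarrow> (\<forall>i j. i < j \<longrightarrow> j < length xs \<longrightarrow> \<not> (Q (xs ! i) \<and> Q (xs ! j)))"
  proof (intro iffI allI impI notI)
    fix i j assume *: "\<forall>i j. i < length xs \<and> Q (xs ! i) \<longrightarrow> j < length xs \<and> Q (xs ! j) \<longrightarrow> i = j"
      "i < j" "j < length xs" "Q (xs ! i) \<and> Q (xs ! j)"
    then have "i = j"
      using less_trans[OF *(2,3)] by blast
    then show False
      using *(2) by simp
  next
    fix i j assume *: "\<forall>i j. i < j \<longrightarrow> j < length xs \<longrightarrow> \<not> (Q (xs ! i) \<and> Q (xs ! j))"
      "i < length xs \<and> Q (xs ! i)" "j < length xs \<and> Q (xs ! j)"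
    show "i = j"
    proof (rule linorder_cases[of i j])
      show "i < j \<Longrightarrow> i = j" "j < i \<Longrightarrow> i = j"
        using * by blast+
    qed
  qed
  ultimately show ?thesis
    by (rule trans)
qed

lemma sorted_imp_C_graph:
  assumes n: "1 \<le> n" "length w \<le> n"
    and valid: "\<forall>a \<in> set w. valid n a"
    and sorted: "sorted_wrt (\<lambda>a b. lex_key a < lex_key b) w"
    and comp: "\<And>a b. a \<in> set w \<Longrightarrow> b \<in> set w \<Longrightarrow> a \<noteq> b \<Longrightarrow> compatible a b"
    and alt: "alternating_letters (set w)"
    and forest: "forest (set w)"
    and cover: "\<And>k. 1 \<le> k \<Longrightarrow> k \<le> n \<Longrightarrow> \<exists>a \<in> set w. 0 < coverage a k"
  shows "map letter_edge w \<in> C_graphs n"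
proof -
  let ?G = "map letter_edge w"
  have "sorted_wrt (<) (map lex_key w)"
    using sorted by (simp add: sorted_wrt_map)
  then have distinct: "distinct w"
    by (simp add: strict_sorted_iff distinct_map)
  have mem: "\<exists>a. a \<in> set w \<and> letter_edge a = e \<and> valid n a" if "e \<in> set ?G" for e
    using that valid by auto
  have X: "X i j \<in> set w" if "(i, j, Neg) \<in> set ?G" for i j
    using mem[OF that] letter_edge_Neg by blast
  have Y: "Y i j \<in> set w" if "(i, j, Pos) \<in> set ?G" "i < j" for i j
    using mem[OF that(1)] that(2) letter_edge_Pos by (metis less_irrefl)
  have Z: "Z i \<in> set w" if "(i, i, s) \<in> set ?G" for i s
    using mem[OF that] letter_edge_loop by blast
  have "\<not> (\<exists>i j k l s t. i < j \<and> j < k \<and> k < l \<and> (i, k, s) \<in> set ?G \<and> (j, l, t) \<in> set ?G)"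
  proof clarify
    fix i j k l s t assume *: "i < j" "j < k" "k < l" "(i, k, s) \<in> set ?G" "(j, l, t) \<in> set ?G"
    obtain a b where ab: "a \<in> set w" "letter_edge a = (i, k, s)" "b \<in> set w" "letter_edge b = (j, l, t)"
      using mem[OF *(4)] mem[OF *(5)] by blast
    then have "lo a = i" "hi a = k" "lo b = j" "hi b = l" "a \<noteq> b"
      using lo_hi_letter_edge[OF ab(2)] lo_hi_letter_edge[OF ab(4)] *(1) by auto
    then show False
      using comp[OF ab(1,3)] * by (simp add: compatible_def crossing_def)
  qed
  moreover have "\<forall>i j k l. (i, j, Pos) \<in> set ?G \<longrightarrow> (k, l, Pos) \<in> set ?G \<longrightarrow> i < j \<longrightarrow> k < l \<longrightarrow> i < l \<and> k < j"
  proof (intro allI impI)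
    fix i j k l assume *: "(i, j, Pos) \<in> set ?G" "(k, l, Pos) \<in> set ?G" "i < j" "k < l"
    show "i < l \<and> k < j"
      using comp[OF Y[OF *(1,3)] Y[OF *(2,4)]] *(3,4) by (cases "i = k \<and> j = l") (auto simp: compatible_def)
  qed
  moreover have "\<forall>i k l. (i, i, Pos) \<in> set ?G \<longrightarrow> (k, l, Pos) \<in> set ?G \<longrightarrow> k < l \<longrightarrow> k \<le> i \<and> i \<le> l"
  proof (intro allI impI)
    fix i k l assume *: "(i, i, Pos) \<in> set ?G" "(k, l, Pos) \<in> set ?G" "k < l"
    show "k \<le> i \<and> i \<le> l"
      using comp[OF Z[OF *(1)] Y[OF *(2,3)]] by (simp add: compatible_def)
  qed
  moreover have "\<not> (\<exists>i j k. (i, i, Pos) \<in> set ?G \<and> (k, j, Neg) \<in> set ?G \<and> k < i \<and> i < j)"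
  proof clarify
    fix i j k assume *: "(i, i, Pos) \<in> set ?G" "(k, j, Neg) \<in> set ?G" "k < i" "i < j"
    show False
      using comp[OF Z[OF *(1)] X[OF *(2)]] *(3,4) by (simp add: compatible_def)
  qed
  moreover have "\<not> (\<exists>i j k l. (i, j, Pos) \<in> set ?G \<and> (k, l, Neg) \<in> set ?G \<and> k \<le> i \<and> i < j \<and> j \<le> l)"
  proof clarify
    fix i j k l assume *: "(i, j, Pos) \<in> set ?G" "(k, l, Neg) \<in> set ?G" "k \<le> i" "i < j" "j \<le> l"
    show False
      using comp[OF Y[OF *(1,4)] X[OF *(2)]] *(3,5) by (simp add: compatible_def)
  qed
  moreover have "length (filter loop_edge ?G) \<le> 1"
    unfolding length_filter_le_1_iff
  proof (intro allI impI notI)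
    fix i j assume ij: "i < j" "j < length ?G" "loop_edge (?G ! i) \<and> loop_edge (?G ! j)"
    then have mem: "w ! i \<in> set w" "w ! j \<in> set w" and "w ! i \<noteq> w ! j"
      using distinct by (auto simp: nth_eq_iff_index_eq)
    then have "compatible (w ! i) (w ! j)"
      using comp by blast
    moreover have "is_loop (w ! i)" "is_loop (w ! j)"
      using ij loop_edge_letter_edge[of n] valid mem by auto
    ultimately show False
      by (cases "w ! i"; cases "w ! j") (auto simp: compatible_def)
  qed
  moreover have "\<exists>j. (1, j, Pos) \<in> set ?G"
  proof -
    obtain a where a: "a \<in> set w" "positive a" "lo a = 1"
      using positive_at_1[of "set w" n] valid n(1) comp alt cover by blast
    have "letter_edge a = (1, hi a, Pos)"
      by (cases a) (use a(2,3) in auto)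
    moreover have "letter_edge a \<in> set ?G"
      using a(1) by simp
    ultimately show ?thesis
      by metis
  qed
  moreover have "signed_graph n ?G"
    using valid signed_edge_letter_edge by (auto simp: signed_graph_iff)
  moreover have "length ?G \<le> n"
    using n(2) by simp
  moreover note forest_no_cycle[OF forest distinct]
  ultimately have "weakly_well_structured n ?G"
    unfolding weakly_well_structured_def loop_edge_def by (intro conjI)
  then show ?thesis
    using alternating_iff[OF valid] alt lexicographic_labels_iff[OF valid distinct] sorted
    by (simp add: C_graphs_def)
qed

text \<open>Index: (1) signed graph, (2) noncrossing, (3) to (6) the pairs positive-positive,
  loop-positive, loop-negative, positive-negative, (7) loops, (8) cycles, (9) positive edge at
  1.\<close>

lemmas weakly_well_structuredD =
  weakly_well_structured_def[THEN iffD1, THEN conjunct1]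
  weakly_well_structured_def[THEN iffD1, THEN conjunct2, THEN conjunct2, THEN conjunct1]
  weakly_well_structured_def[THEN iffD1, THEN conjunct2, THEN conjunct2, THEN conjunct2, THEN conjunct1]
  weakly_well_structured_def[THEN iffD1, THEN conjunct2, THEN conjunct2, THEN conjunct2, THEN conjunct2, THEN conjunct1]
  weakly_well_structured_def[THEN iffD1, THEN conjunct2, THEN conjunct2, THEN conjunct2, THEN conjunct2, THEN conjunct2, THEN conjunct1]
  weakly_well_structured_def[THEN iffD1, THEN conjunct2, THEN conjunct2, THEN conjunct2, THEN conjunct2, THEN conjunct2, THEN conjunct2, THEN conjunct1]
  weakly_well_structured_def[THEN iffD1, THEN conjunct2, THEN conjunct2, THEN conjunct2, THEN conjunct2, THEN conjunct2, THEN conjunct2, THEN conjunct2, THEN conjunct1]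
  weakly_well_structured_def[THEN iffD1, THEN conjunct2, THEN conjunct2, THEN conjunct2, THEN conjunct2, THEN conjunct2, THEN conjunct2, THEN conjunct2, THEN conjunct2, THEN conjunct1]
  weakly_well_structured_def[THEN iffD1, THEN conjunct2, THEN conjunct2, THEN conjunct2, THEN conjunct2, THEN conjunct2, THEN conjunct2, THEN conjunct2, THEN conjunct2, THEN conjunct2]

lemma C_graph_letters:
  assumes "G \<in> C_graphs n" "1 \<le> n"
  obtains w where "G = map letter_edge w" "map edge_letter G = w" "\<forall>a \<in> set w. valid n a"
    "sorted_wrt (\<lambda>a b. lex_key a < lex_key b) w" "sorted_wrt precedes w" "alternating_letters (set w)"
    "\<And>k. 1 \<le> k \<Longrightarrow> \<exists>a \<in> set w. 0 < coverage a k"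
proof -
  define w where "w = map edge_letter G"
  have wws: "weakly_well_structured n G"
    using assms(1) by (simp add: C_graphs_def)
  have edges: "\<forall>e \<in> set G. signed_edge n e"
    using weakly_well_structuredD(1)[OF wws] by (simp add: signed_graph_iff)
  then have "letter_edge (edge_letter e) = e" if "e \<in> set G" for e
    using edge_letter_valid(2) that by blast
  then have "map (letter_edge \<circ> edge_letter) G = G"
    by (intro map_idI) simp
  then have G: "G = map letter_edge w"
    by (simp add: w_def)
  have valid: "\<forall>a \<in> set w. valid n a"
    using edges edge_letter_valid(1) unfolding w_def set_map by blast
  have loops: "\<not> (loop_edge (G ! i) \<and> loop_edge (G ! j))" if "i < j" "j < length G" for i j
    using weakly_well_structuredD(7)[OF wws, folded loop_edge_def] that
    unfolding length_filter_le_1_iff by blast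
  \<comment> \<open>A repeated nonloop edge is a cycle on two vertices, and a repeated loop exceeds
    the bound on loops.\<close>
  have "w ! i \<noteq> w ! j" if ij: "i < j" "j < length w" for i j
  proof
    assume "w ! i = w ! j"
    then have eq: "G ! i = G ! j"
      using ij G by simp
    obtain k l s where kls: "G ! i = (k, l, s)"
      by (cases "G ! i")
    then have "k \<noteq> l"
      using loops[of i j] ij eq G by (auto simp: loop_edge_def)
    then have "has_nonloop_cycle G"
      using parallel_edges_cycle[OF ij(1) _ eq kls] ij G by simp
    then show False
      using weakly_well_structuredD(8)[OF wws] by simp
  qed
  then have distinct: "distinct w"
    by (metis distinct_conv_nth linorder_neqE_nat)
  have sorted: "sorted_wrt (\<lambda>a b. lex_key a < lex_key b) w"
    using assms(1) lexicographic_labels_iff[OF valid distinct] G by (simp add: C_graphs_def)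
  have alt: "alternating_letters (set w)"
    using assms(1) alternating_iff[OF valid] G by (simp add: C_graphs_def)
  have edge: "letter_edge a \<in> set G" if "a \<in> set w" for a
    using that G by auto
  have cross: "\<not> crossing a b" if "a \<in> set w" "b \<in> set w" for a b
  proof -
    obtain s t where "letter_edge a = (lo a, hi a, s)" "letter_edge b = (lo b, hi b, t)"
      using lo_hi_letter_edge prod_cases3 by metis
    then have "(lo a, hi a, s) \<in> set G" "(lo b, hi b, t) \<in> set G"
      using edge[OF that(1)] edge[OF that(2)] by simp_all
    then show ?thesis
      using weakly_well_structuredD(2)[OF wws] unfolding crossing_def by blast
  qed
  have admissible: "admissible a b" if ab: "a \<in> set w" "b \<in> set w" "a \<noteq> b" for a b
  proof -
    have e: "letter_edge a \<in> set G" "letter_edge b \<in> set G" "valid n a" "valid n b"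
      using edge ab valid by auto
    have ZZ: "\<not> (is_loop a \<and> is_loop b)"
    proof
      assume "is_loop a \<and> is_loop b"
      then have "loop_edge (letter_edge a)" "loop_edge (letter_edge b)"
        using loop_edge_letter_edge e by auto
      moreover obtain i j where "i < length w" "w ! i = a" "j < length w" "w ! j = b"
        using ab by (metis in_set_conv_nth)
      moreover from this have "i < j \<or> j < i"
        using ab(3) by (metis linorder_neqE_nat)
      ultimately show False
        using loops[of i j] loops[of j i] G by auto
    qed
    show ?thesis
    proof (cases a; cases b)
      fix i k l assume *: "a = Z i" "b = X k l"
      then have "(i, i, Pos) \<in> set G" "(k, l, Neg) \<in> set G" 
        using e by simp_all
      then show ?thesis
        using weakly_well_structuredD(5)[OF wws] unfolding * admissible.simps by blast
    next
      fix i k l assume *: "a = Z i" "b = Y k l"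
      then have "(i, i, Pos) \<in> set G" "(k, l, Pos) \<in> set G" "k < l"
        using e by simp_all
      then show ?thesis
        using weakly_well_structuredD(4)[OF wws] unfolding * admissible.simps by blast
    next
      fix i j k l assume *: "a = Y i j" "b = X k l"
      then have "(i, j, Pos) \<in> set G" "(k, l, Neg) \<in> set G" "i < j"
        using e by simp_all
      then show ?thesis
        using weakly_well_structuredD(6)[OF wws] unfolding * admissible.simps by blast
    next
      fix i j k l assume *: "a = Y i j" "b = Y k l"
      then have "(i, j, Pos) \<in> set G" "(k, l, Pos) \<in> set G" "i < j" "k < l"
        using e by simp_all
      then show ?thesis
        using weakly_well_structuredD(3)[OF wws] unfolding * admissible.simps by blast
    qed (use ZZ in auto)
  qed
  have comp: "compatible a b" if "a \<in> set w" "b \<in> set w" "a \<noteq> b" for a b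
    using cross admissible that by (auto simp: compatible_def)
  have prec: "sorted_wrt precedes w"
    by (rule sorted_lex_key_precedes[OF sorted valid comp alt])
  \<comment> \<open>A positive letter starting at 1 contributes to every partial sum from 1 on, so
    one such edge serves all \<open>k\<close>.\<close>
  have cover: "\<exists>a \<in> set w. 0 < coverage a k" if "1 \<le> k" for k
  proof -
    obtain j where "(1, j, Pos) \<in> set G"
      using weakly_well_structuredD(9)[OF wws] ..
    then obtain a where "a \<in> set w" "letter_edge a = (1, j, Pos)"
      using G by auto
    then show ?thesis
      using valid lo_hi_letter_edge[of a 1 j Pos] that coverage_pos_iff[of n a k] by auto
  qed
  show thesis
    by (rule that[OF G w_def[symmetric] valid sorted prec alt cover])
qed

lemma sorted_lex_key_unique:
  assumes "sorted_wrt (\<lambda>a b. lex_key a < lex_key b) u" "sorted_wrt (\<lambda>a b. lex_key a < lex_key b) v"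
    "set u = set v" "\<forall>a \<in> set u. valid n a"
  shows "u = v"
proof -
  have "sorted_wrt (<) (map lex_key u)" "sorted_wrt (<) (map lex_key v)"
    using assms(1,2) by (simp_all add: sorted_wrt_map)
  moreover have "set (map lex_key u) = set (map lex_key v)"
    using assms(3) by simp
  ultimately have "map lex_key u = map lex_key v"
    by (intro sorted_distinct_set_unique) (simp_all add: strict_sorted_iff)
  then show ?thesis
    using assms(3,4) lex_key_inj[of n] by (intro map_inj_on[of lex_key u v]) (auto simp: inj_on_def)
qed

section \<open>Extracting the coefficients\<close>

definition letter_sum :: "letter set \<Rightarrow> nat \<Rightarrow> int" where
  "letter_sum A = wsum (\<lambda>_. 1) A"

lemma indicator_weighting: "(\<lambda>a. of_bool (a \<in> A)) \<in> weightings (letter_sum A) A"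
  by (auto simp: weightings_def letter_sum_def wsum_def intro!: sum.cong)

text \<open>Common ground of both sides of the identity: it holds for the monomials of an
  irreducible polynomial and for those of the graphs, and it suffices for recovering letters and
  weights.\<close>

definition alternating_monomial :: "nat \<Rightarrow> monomial \<Rightarrow> bool" where
  "alternating_monomial n m \<longleftrightarrow> well_ordered m \<and> (\<forall>a \<in> letters m. valid n a) \<and>
    alternating_letters (letters m)"

lemma finite_letters: "finite (letters m)"
  by (cases m rule: monomial_word) (simp add: letters.abs_eq)

lemma alternating_monomial_configuration:
  assumes "alternating_monomial n m" "f \<in> weightings p (letters m)"
  shows "configuration n f" "{a. 0 < f a} = letters m" "weight_vector f = p"
proof -
  obtain w where m: "m = abs_monomial w"
    by (rule monomial_word)
  show eq: "{a. 0 < f a} = letters m"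
    using weightings_pos[OF assms(2)] by auto
  show "weight_vector f = p"
    unfolding eq using weightings_wsum[OF assms(2)] by auto
  have "compatible a b" if "a \<in> letters m" "b \<in> letters m" "a \<noteq> b" for a b
    using sorted_precedes_compatible[of w a b] assms(1) that
    by (simp add: alternating_monomial_def m monomial_simps)
  then show "configuration n f"
    using assms(1) finite_letters[of m]
    by (simp add: configuration_def eq weightings_pos[OF assms(2)] alternating_monomial_def
        alternating_letters_def)
qed

lemma alternating_monomial_letters_inj:
  assumes "alternating_monomial n m" "alternating_monomial n m'" "letters m = letters m'"
  shows "m = m'"
proof -
  obtain u v where "m = abs_monomial u" "m' = abs_monomial v"
    using monomial_word by metis
  then show ?thesis
    using assms sorted_wrt_precedes_unique[of u v n] abs_monomial_eqI
    by (simp add: alternating_monomial_def monomial_simps)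
qed

text \<open>Weight 1 on every letter of \<open>m\<close> is a configuration with this sum. By
  uniqueness, any weighting on \<open>m'\<close> with the same sum equals it, so the supports agree,
  and sorted monomials with the same letters coincide.\<close>

lemma card_weightings_letter_sum:
  assumes "alternating_monomial n m" "alternating_monomial n m'"
  shows "card (weightings (letter_sum (letters m)) (letters m')) = of_bool (m' = m)"
proof -
  let ?p = "letter_sum (letters m)" and ?f = "\<lambda>a. of_bool (a \<in> letters m)"
  note f = alternating_monomial_configuration[OF assms(1) indicator_weighting]
  have g: "g = ?f \<and> m' = m" if g: "g \<in> weightings ?p (letters m')" for g
  proof -
    note g = alternating_monomial_configuration[OF assms(2) g]
    have "weight_vector g v = weight_vector ?f v" for v
      unfolding g(3) f(3) by (rule refl)
    then have eq: "g = ?f"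
      by (rule configuration_unique[OF g(1) f(1)])
    have "letters m' = letters m"
      unfolding g(2)[symmetric] eq by (rule f(2))
    then show ?thesis
      using eq alternating_monomial_letters_inj[OF assms(2,1)] by blast
  qed
  show ?thesis
  proof (cases "m' = m")
    case True
    then have "weightings ?p (letters m') = {?f}"
      using g indicator_weighting[of "letters m"] by blast
    then show ?thesis
      using True by simp
  next
    case False
    then have "weightings ?p (letters m') = {}"
      using g by blast
    then show ?thesis
      using False by simp
  qed
qed

lemma partial_sums_letter_sum:
  "(\<Sum>v\<le>k. letter_sum A v) = (\<Sum>a\<in>A. coverage a k)"
  by (simp add: letter_sum_def sum_wsum)

lemma card_weightings_path:
  assumes "weightings p (path n) \<noteq> {}" "1 \<le> n"
  shows "card (weightings p (path n)) = 1"
proof -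
  obtain f where "f \<in> weightings p (path n)"
    using assms(1) by blast
  then have "weightings p (path n) = {f}"
    using weightings_path_unique[OF _ _ assms(2)] by blast
  then show ?thesis
    by simp
qed

lemma mult_monom_1_eq:
  assumes "q * monom 1 d = (monom 1 n :: rat poly)"
  shows "d \<le> n" "q = monom 1 (n - d)"
proof -
  have "coeff (monom 1 d * q) n = 1"
    using assms by (simp add: mult.commute)
  then show "d \<le> n"
    by (simp add: coeff_monom_mult split: if_splits)
  then have "q * monom 1 d = monom 1 (n - d) * monom 1 d"
    using assms by (simp add: mult_monom)
  then show "q = monom 1 (n - d)"
    by simp
qed

lemma poly_mapping_sum_single:
  "(P :: 'a \<Rightarrow>\<^sub>0 'b :: comm_monoid_add) = (\<Sum>m\<in>Poly_Mapping.keys P. Poly_Mapping.single m (Poly_Mapping.lookup P m))"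
  by (rule poly_mapping_eqI)
    (auto simp: lookup_sum lookup_single when_def in_keys_iff)

lemma graph_monomial_word_poly: "graph_monomial G = word_poly 0 (map edge_letter G)"
proof (induction G)
  case Nil
  show ?case
    by (simp add: graph_monomial_def word_poly_def zero_monomial_def[symmetric])
next
  case (Cons e G)
  then show ?case
    by (simp add: graph_monomial_def var_word_poly word_poly_mult)
qed

lemma beta_power: "\<beta> ^ k = word_poly k []"
proof (induction k)
  case 0
  show ?case
    by (simp add: word_poly_def zero_monomial_def[symmetric])
next
  case (Suc k)
  then show ?case
    by (simp add: beta_word_poly word_poly_mult)
qed

theorem theorem31:
  fixes n :: nat and P :: ncpoly
  assumes "n \<ge> 1"
    and "reduced_form n (w_C n) P"
  shows "P = (\<Sum>G \<in> C_graphs n. \<beta> ^ (n - length G) * graph_monomial G)"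
proof -
  let ?W = "\<lambda>m. weightings (letter_sum (letters m)) (path n)"
  have "(reduction_step n)\<^sup>*\<^sup>* (w_C n) P" and irreducible: "\<not> (\<exists>Q. reduction_step n P Q)"
    using assms(2) by (auto simp: reduced_form_def)
  moreover have "\<forall>m \<in> Poly_Mapping.keys (w_C n). good n m"
    using good_path_word[OF assms(1)] by (simp add: w_C_word_poly word_poly_def)
  ultimately have good: "\<And>m. m \<in> Poly_Mapping.keys P \<Longrightarrow> good n m"
    and ext: "\<And>p. linear_extension (weighting_count p) P = linear_extension (weighting_count p) (w_C n)"
    using reductions_good by blast+
  have count: "linear_extension (weighting_count p) P = monom (of_nat (card (weightings p (path n)))) n" for p
    using assms(1) unfolding ext
    by (simp add: w_C_word_poly word_poly_def weighting_count_def monomial_simps set_path_word mult_monom)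
      (simp add: path_word_def)
  have alt: "alternating_monomial n m" if "m \<in> Poly_Mapping.keys P" for m
    using irreducible_alternating[OF irreducible that good[OF that]] good[OF that]
    by (simp add: good_def alternating_monomial_def)
  have coeff: "linear_extension (weighting_count (letter_sum (letters m))) P =
      Poly_Mapping.lookup P m * monom 1 (total_degree m)" if m: "m \<in> Poly_Mapping.keys P" for m
  proof -
    have "linear_extension (weighting_count (letter_sum (letters m))) P =
        (\<Sum>m'\<in>Poly_Mapping.keys P. if m' = m then Poly_Mapping.lookup P m' * monom 1 (total_degree m') else 0)"
      unfolding linear_extension_def weighting_count_def
      using card_weightings_letter_sum[OF alt[OF m] alt] by (intro sum.cong) auto
    then show ?thesis
      using m by simp
  qed
  \<comment> \<open>Two evaluations of one functional are compared. A key has a nonzero coefficient,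
    so the path has a weighting, necessarily just one; comparing powers of \<beta> then yields the
    degree bound together with the coefficient.\<close>
  have key: "?W m \<noteq> {} \<and> total_degree m \<le> n \<and> Poly_Mapping.lookup P m = monom 1 (n - total_degree m)"
    if m: "m \<in> Poly_Mapping.keys P" for m
  proof -
    have eq: "Poly_Mapping.lookup P m * monom 1 (total_degree m) = monom (of_nat (card (?W m))) n"
      using coeff[OF m] count by simp
    moreover have "Poly_Mapping.lookup P m * monom 1 (total_degree m) \<noteq> 0"
      using m by (simp add: in_keys_iff)
    ultimately have W: "?W m \<noteq> {}"
      by auto
    then have "Poly_Mapping.lookup P m * monom 1 (total_degree m) = monom 1 n"
      using eq card_weightings_path[OF W assms(1)] by simp
    then show ?thesis
      using W mult_monom_1_eq by blast
  qed
  let ?m = "\<lambda>G. abs_monomial (map edge_letter G)"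
  have keys: "Poly_Mapping.keys P = ?m ` C_graphs n"
  proof (intro equalityI subsetI)
    fix m assume m: "m \<in> Poly_Mapping.keys P"
    obtain w where w: "m = abs_monomial w"
      by (rule monomial_word)
    have sorted: "sorted_wrt precedes w" and valid: "\<forall>a \<in> set w. valid n a"
      and forest: "forest (set w)" and altw: "alternating_letters (set w)"
      using good[OF m] alt[OF m] by (auto simp: good_def alternating_monomial_def w monomial_simps)
    \<comment> \<open>The lexicographic representative of the commutation class is the edge list of
      the desired graph.\<close>
    define L where "L = sort_key lex_key w"
    have L: "set L = set w" "length L = length w" "distinct L"
      using sorted_wrt_precedes_distinct[OF sorted valid] by (simp_all add: L_def)
    have comp: "compatible a b" if "a \<in> set L" "b \<in> set L" "a \<noteq> b" for a b
      using sorted_precedes_compatible[OF sorted] that L(1) by simp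
    have "sorted_wrt (\<lambda>a b. lex_key a \<le> lex_key b) L"
      using sorted_sort_key[of lex_key w] by (simp add: L_def sorted_map)
    then have lex: "sorted_wrt (\<lambda>a b. lex_key a < lex_key b) L"
      using L valid lex_key_inj unfolding sorted_wrt_iff_nth_less distinct_conv_nth
      by (metis (no_types, lifting) less_trans nat_neq_iff nth_mem order_le_less)
    \<comment> \<open>A weighting of the path makes all partial sums of the letter sum positive, and
      a positive partial sum needs a letter contributing to it. \<open>positive_at_1\<close> turns
      this into the positive edge at vertex 1.\<close>
    have "\<exists>a \<in> set L. 0 < coverage a k" if k: "1 \<le> k" "k \<le> n" for k
    proof -
      obtain f where "f \<in> ?W m"
        using key[OF m] by blast
      from weightings_path_partial_sums[OF this k] have "0 < (\<Sum>a\<in>set w. coverage a k)"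
        by (simp add: partial_sums_letter_sum w letters.abs_eq)
      then show ?thesis
        unfolding L(1) by (meson not_less sum_nonpos)
    qed
    then have G: "map letter_edge L \<in> C_graphs n"
      using sorted_imp_C_graph[OF assms(1) _ _ lex comp] key[OF m] L valid forest altw
      by (simp add: w total_degree.abs_eq)
    have "sorted_wrt precedes L"
      using sorted_lex_key_precedes[OF lex _ comp] L(1) valid altw by simp
    then have "m = abs_monomial L"
      using abs_monomial_eqI sorted_wrt_precedes_unique[OF sorted _ _ valid] L(1) w by simp
    moreover have "map edge_letter (map letter_edge L) = L"
      unfolding map_map using L(1) valid edge_letter_letter_edge[of n] by (intro map_idI) simp
    ultimately show "m \<in> ?m ` C_graphs n"
      using G by force
  next
    fix m assume "m \<in> ?m ` C_graphs n"
    then obtain G where "G \<in> C_graphs n" and m: "m = ?m G"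
      by blast
    from C_graph_letters[OF this(1) assms(1)] obtain w where w: "map edge_letter G = w"
      "\<forall>a \<in> set w. valid n a" "sorted_wrt precedes w" "alternating_letters (set w)"
      and cover: "\<And>k. 1 \<le> k \<Longrightarrow> \<exists>a \<in> set w. 0 < coverage a k"
      by metis
    have altm: "alternating_monomial n m"
      using w by (simp add: alternating_monomial_def m monomial_simps)
    have "?W m \<noteq> {}"
    proof (rule weightings_path_exists[OF assms(1)])
      fix v assume "v < 1 \<or> n < v"
      then have "vec a v = 0" if "a \<in> set w" for a
        using w(2) that by (cases a) fastforce+
      then show "letter_sum (letters m) v = 0"
        by (simp add: letter_sum_def wsum_def m w(1) letters.abs_eq)
    next
      fix k :: nat assume "1 \<le> k"
      then obtain a where a: "a \<in> set w" "0 < coverage a k"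
        using cover by blast
      show "0 < (\<Sum>v\<le>k. letter_sum (letters m) v)"
        unfolding partial_sums_letter_sum m letters.abs_eq w(1)
        by (rule sum_pos2[where f = "\<lambda>a. coverage a k", OF finite_set a]) (use w(2) coverage_nonneg[of n] in blast)
    qed
    \<comment> \<open>The functional has the value \<open>monom 1 n\<close>, which is nonzero, so
      some monomial of \<open>P\<close> has a weighting with the letter sum of \<open>m\<close>;
      uniqueness identifies it with \<open>m\<close>.\<close>
    from card_weightings_path[OF this assms(1)]
    have "linear_extension (weighting_count (letter_sum (letters m))) P \<noteq> 0"
      unfolding count by simp
    then obtain m' where m': "m' \<in> Poly_Mapping.keys P" "weighting_count (letter_sum (letters m)) m' \<noteq> 0"
      unfolding linear_extension_def by (elim sum.not_neutral_contains_not_neutral) simp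
    then have "m' = m"
      using card_weightings_letter_sum[OF altm alt[OF m'(1)]]
      by (auto simp: weighting_count_def split: if_splits)
    then show "m \<in> Poly_Mapping.keys P"
      using m'(1) by simp
  qed
  \<comment> \<open>A commutation class determines its set of letters, and the lexicographic labels
    recover the edge list from that set.\<close>
  have inj: "inj_on ?m (C_graphs n)"
  proof (rule inj_onI)
    fix G H assume GH: "G \<in> C_graphs n" "H \<in> C_graphs n" "?m G = ?m H"
    from C_graph_letters[OF GH(1) assms(1)] obtain u where u: "G = map letter_edge u" "map edge_letter G = u"
      "\<forall>a \<in> set u. valid n a" "sorted_wrt (\<lambda>a b. lex_key a < lex_key b) u"
      by metis
    from C_graph_letters[OF GH(2) assms(1)] obtain v where v: "H = map letter_edge v" "map edge_letter H = v"
      "sorted_wrt (\<lambda>a b. lex_key a < lex_key b) v"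
      by metis
    have "set u = set v"
      using arg_cong[OF GH(3), of letters] u(2) v(2) by (simp only: letters.abs_eq)
    then show "G = H"
      using sorted_lex_key_unique[OF u(4) v(3) _ u(3)] u(1) v(1) by simp
  qed
  have "P = (\<Sum>m\<in>?m ` C_graphs n. Poly_Mapping.single m (Poly_Mapping.lookup P m))"
    using poly_mapping_sum_single[of P] by (simp only: keys)
  also have "\<dots> = (\<Sum>G\<in>C_graphs n. Poly_Mapping.single (?m G) (Poly_Mapping.lookup P (?m G)))"
    by (simp add: sum.reindex[OF inj])
  also have "\<dots> = (\<Sum>G\<in>C_graphs n. \<beta> ^ (n - length G) * graph_monomial G)"
  proof (rule sum.cong[OF refl])
    fix G assume "G \<in> C_graphs n"
    then have "?m G \<in> Poly_Mapping.keys P"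
      using keys by blast
    then have "Poly_Mapping.lookup P (?m G) = monom 1 (n - length G)"
      using key by (simp add: total_degree.abs_eq)
    then show "Poly_Mapping.single (?m G) (Poly_Mapping.lookup P (?m G)) = \<beta> ^ (n - length G) * graph_monomial G"
      by (simp add: beta_power graph_monomial_word_poly word_poly_mult) (simp add: word_poly_def)
  qed
  finally show ?thesis .
qed

end
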